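(* The function class $\mathsf{FCC}$ is closed under composition: if $F,G\in\mathsf{FCC}$ then the function $X\mapsto F(G(X))$ is in $\mathsf{FCC}$.
   Context: $\mathsf{CC}$ is the class of relations computed by $\mathsf{AC}^0$-uniform (i.e., computable by a function in $\mathsf{FAC}^0$) families of polynomial size annotated comparator circuits. Here a comparator gate maps an input pair $(p,q)$ on two wires to $(p\wedge q,p\vee q)$, and an annotated comparator circuit has wires, a sequence of comparator gates, a distinguished output wire, and each wire's input annotated by an input bit $x_i$, its negation $\neg x_i$, or a constant. $\mathsf{FCC}$ is the class of $p$-bounded string functions $F$ (i.e., $|F(X)|$ bounded by a polynomial in $|X|$) whose bit graph $B_F(i,X)$ ("the $i$th bit of $F(X)$ is $1$") is in $\mathsf{CC}$. *)

theory Defs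
  imports
    "HOL-Library.FSet"
    "HOL-Library.More_List"
    "HOL-Library.Nat_Bijection"
    "HOL-Computational_Algebra.Polynomial"
begin

section \<open>Strings\<close>

text \<open>
  Two-sorted convention: relations and functions take number arguments, which count as unary,
  and binary string arguments. A string is a finite set of numbers (the positions of its
  \<open>1\<close>-bits) and its length is one plus its largest element, or \<open>0\<close> if it is empty. Hence a
  string, and in particular its length, is determined by its bits. This fails for bit lists,
  where trailing zeros make two different strings agree on which bits are \<open>1\<close>, so that a
  function would not be determined by its bit graph.
\<close>

type_synonym str = "nat fset"

definition slen :: "str \<Rightarrow> nat" where
  "slen X = (if X = {||} then 0 else Suc (fMax X))"

text \<open>
  A relation \<open>R(x\<^sub>1,\<dots>,x\<^sub>k,X\<^sub>1,\<dots>,X\<^sub>l)\<close> or function with \<open>k\<close> number and \<open>l\<close> string arguments takes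
  two lists; its values on lists of other lengths are irrelevant.
\<close>

type_synonym relation = "nat list \<Rightarrow> str list \<Rightarrow> bool"
type_synonym str_fun = "nat list \<Rightarrow> str list \<Rightarrow> str"

definition input_size :: "nat list \<Rightarrow> str list \<Rightarrow> nat" where
  "input_size xs Xs = sum_list xs + sum_list (map slen Xs)"

definition p_bounded :: "nat \<Rightarrow> nat \<Rightarrow> str_fun \<Rightarrow> bool" where
  "p_bounded k l F \<longleftrightarrow>
    (\<exists>p :: nat poly. \<forall>xs Xs. length xs = k \<longrightarrow> length Xs = l \<longrightarrow>
      slen (F xs Xs) \<le> poly p (input_size xs Xs))"

text \<open>The bit graph of \<open>F\<close> has the bit index \<open>i\<close> as an additional first number argument.\<close>

definition bit_graph :: "str_fun \<Rightarrow> relation" where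
  "bit_graph F = (\<lambda>ys Xs. hd ys |\<in>| F (tl ys) Xs)"

definition function_class ::
    "(nat \<Rightarrow> nat \<Rightarrow> relation set) \<Rightarrow> nat \<Rightarrow> nat \<Rightarrow> str_fun set" where
  "function_class \<C> k l = {F. p_bounded k l F \<and> bit_graph F \<in> \<C> (Suc k) l}"


section \<open>Uniform \<open>AC\<^sup>0\<close>\<close>

text \<open>
  Uniform \<open>AC\<^sup>0\<close> is first-order definability with addition and multiplication; in the two-sorted
  setting, definability by \<open>\<Sigma>\<^sub>0\<^sup>B\<close> formulas: all number quantifiers are bounded by terms
  (polynomials in the number arguments and the lengths of the string arguments) and there are
  no string quantifiers. Number variables are de Bruijn indices; string variables are never
  bound. The bound of a quantifier is evaluated outside its scope.
\<close>

datatype trm =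
    NVar nat
  | Zero
  | One
  | Plus trm trm
  | Times trm trm
  | Len nat

datatype fm =
    NEq trm trm
  | NLe trm trm
  | SEq nat nat
  | Bit nat trm
  | Neg fm
  | Conj fm fm
  | Disj fm fm
  | BEx trm fm
  | BAll trm fm

primrec trm_val :: "(nat \<Rightarrow> nat) \<Rightarrow> (nat \<Rightarrow> str) \<Rightarrow> trm \<Rightarrow> nat" where
  "trm_val v s (NVar i) = v i"
| "trm_val v s Zero = 0"
| "trm_val v s One = 1"
| "trm_val v s (Plus t u) = trm_val v s t + trm_val v s u"
| "trm_val v s (Times t u) = trm_val v s t * trm_val v s u"
| "trm_val v s (Len j) = slen (s j)"

primrec fm_val :: "(nat \<Rightarrow> nat) \<Rightarrow> (nat \<Rightarrow> str) \<Rightarrow> fm \<Rightarrow> bool" where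
  "fm_val v s (NEq t u) \<longleftrightarrow> trm_val v s t = trm_val v s u"
| "fm_val v s (NLe t u) \<longleftrightarrow> trm_val v s t \<le> trm_val v s u"
| "fm_val v s (SEq i j) \<longleftrightarrow> s i = s j"
| "fm_val v s (Bit j t) \<longleftrightarrow> trm_val v s t |\<in>| s j"
| "fm_val v s (Neg \<phi>) \<longleftrightarrow> \<not> fm_val v s \<phi>"
| "fm_val v s (Conj \<phi> \<psi>) \<longleftrightarrow> fm_val v s \<phi> \<and> fm_val v s \<psi>"
| "fm_val v s (Disj \<phi> \<psi>) \<longleftrightarrow> fm_val v s \<phi> \<or> fm_val v s \<psi>"
| "fm_val v s (BEx t \<phi>) \<longleftrightarrow> (\<exists>y \<le> trm_val v s t. fm_val (case_nat y v) s \<phi>)"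
| "fm_val v s (BAll t \<phi>) \<longleftrightarrow> (\<forall>y \<le> trm_val v s t. fm_val (case_nat y v) s \<phi>)"

definition AC0 :: "nat \<Rightarrow> nat \<Rightarrow> relation set" where
  "AC0 k l = {R. \<exists>\<phi>. \<forall>xs Xs. length xs = k \<longrightarrow> length Xs = l \<longrightarrow>
     (R xs Xs \<longleftrightarrow> fm_val (nth_default 0 xs) (nth_default {||} Xs) \<phi>)}"

definition FAC0 :: "nat \<Rightarrow> nat \<Rightarrow> str_fun set" where
  "FAC0 = function_class AC0"


section \<open>Annotated comparator circuits\<close>

text \<open>
  \<open>PosIn j i\<close> and \<open>NegIn j i\<close> annotate a wire with bit \<open>i\<close> of the \<open>j\<close>-th input string and with its
  negation. Wires are numbered by their position in the list of annotations.
\<close>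

datatype annotation = PosIn nat nat | NegIn nat nat | Const bool

datatype circuit =
  Circuit (annots: "annotation list") (gates: "(nat \<times> nat) list") (out_wire: nat)

primrec annotation_ok :: "nat list \<Rightarrow> annotation \<Rightarrow> bool" where
  "annotation_ok ns (PosIn j i) \<longleftrightarrow> j < length ns \<and> i < ns ! j"
| "annotation_ok ns (NegIn j i) \<longleftrightarrow> j < length ns \<and> i < ns ! j"
| "annotation_ok ns (Const b) \<longleftrightarrow> True"

definition circuit_ok :: "nat list \<Rightarrow> circuit \<Rightarrow> bool" where
  "circuit_ok ns C \<longleftrightarrow>
     (\<forall>\<alpha> \<in> set (annots C). annotation_ok ns \<alpha>) \<and>
     (\<forall>(a, b) \<in> set (gates C). a < length (annots C) \<and> b < length (annots C) \<and> a \<noteq> b) \<and>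
     out_wire C < length (annots C)"

primrec annotation_val :: "str list \<Rightarrow> annotation \<Rightarrow> bool" where
  "annotation_val Xs (PosIn j i) \<longleftrightarrow> i |\<in>| Xs ! j"
| "annotation_val Xs (NegIn j i) \<longleftrightarrow> i |\<notin>| Xs ! j"
| "annotation_val Xs (Const b) \<longleftrightarrow> b"

fun comparator :: "nat \<times> nat \<Rightarrow> bool list \<Rightarrow> bool list" where
  "comparator (a, b) v = v[a := v ! a \<and> v ! b, b := v ! a \<or> v ! b]"

definition circuit_val :: "circuit \<Rightarrow> str list \<Rightarrow> bool" where
  "circuit_val C Xs = fold comparator (gates C) (map (annotation_val Xs) (annots C)) ! out_wire C"

definition circuit_size :: "circuit \<Rightarrow> nat" where
  "circuit_size C = length (annots C) + length (gates C)"

text \<open>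
  Circuits as strings, using the (polynomial) Cantor pairing function: the positions of the
  \<open>1\<close>-bits are the codes of \<open>(0, w, annotation of wire w)\<close>, \<open>(1, t, a, b)\<close> where \<open>(a, b)\<close> is the
  \<open>t\<close>-th gate, and \<open>(2, 0, 0, output wire)\<close>.
\<close>

definition quad_encode :: "nat \<Rightarrow> nat \<Rightarrow> nat \<Rightarrow> nat \<Rightarrow> nat" where
  "quad_encode a b c d = prod_encode (a, prod_encode (b, prod_encode (c, d)))"

primrec annotation_code :: "nat \<Rightarrow> annotation \<Rightarrow> nat" where
  "annotation_code w (PosIn j i) = quad_encode 0 w 0 (prod_encode (j, i))"
| "annotation_code w (NegIn j i) = quad_encode 0 w 1 (prod_encode (j, i))"
| "annotation_code w (Const b) = quad_encode 0 w 2 (of_bool b)"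

definition circuit_code :: "circuit \<Rightarrow> str" where
  "circuit_code C = fset_of_list (
     map (\<lambda>w. annotation_code w (annots C ! w)) [0..<length (annots C)] @
     map (\<lambda>t. quad_encode 1 t (fst (gates C ! t)) (snd (gates C ! t))) [0..<length (gates C)] @
     [quad_encode 2 0 0 (out_wire C)])"

lemma quad_encode_eq [simp]:
  "quad_encode a b c d = quad_encode a' b' c' d' \<longleftrightarrow> a = a' \<and> b = b' \<and> c = c' \<and> d = d'"
  by (simp add: quad_encode_def)

lemma annotation_code_eq: "annotation_code w \<alpha> = annotation_code w' \<beta> \<longleftrightarrow> w = w' \<and> \<alpha> = \<beta>"
  by (cases \<alpha>; cases \<beta>) (auto split: if_splits)

lemma annotation_code_neq:
  "a \<noteq> 0 \<Longrightarrow> annotation_code w \<alpha> \<noteq> quad_encode a b c d"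
  "a \<noteq> 0 \<Longrightarrow> quad_encode a b c d \<noteq> annotation_code w \<alpha>"
  by (cases \<alpha>; simp)+

lemma annotation_code_mem:
  "annotation_code w \<alpha> |\<in>| circuit_code C \<longleftrightarrow> w < length (annots C) \<and> annots C ! w = \<alpha>"
  by (auto simp: circuit_code_def fset_of_list_elem annotation_code_eq annotation_code_neq)

lemma gate_code_mem:
  "quad_encode 1 t a b |\<in>| circuit_code C \<longleftrightarrow> t < length (gates C) \<and> gates C ! t = (a, b)"
  by (force simp: circuit_code_def fset_of_list_elem annotation_code_neq)

lemma out_code_mem: "quad_encode 2 0 0 a |\<in>| circuit_code C \<longleftrightarrow> a = out_wire C"
  by (auto simp: circuit_code_def fset_of_list_elem annotation_code_neq)

lemma list_eqI_mem:
  assumes "\<And>i x. i < length xs \<and> xs ! i = x \<longleftrightarrow> i < length ys \<and> ys ! i = x"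
  shows "xs = ys"
proof (rule nth_equalityI)
  have "i < length xs \<longleftrightarrow> i < length ys" for i using assms by blast
  then show "length xs = length ys" by (metis linorder_neqE_nat nat_less_le)
  show "xs ! i = ys ! i" if "i < length xs" for i using assms that by blast
qed

lemma inj_circuit_code: "inj circuit_code"
proof (rule injI)
  fix C D assume eq: "circuit_code C = circuit_code D"
  have "annots C = annots D"
    using annotation_code_mem[of _ _ C] annotation_code_mem[of _ _ D] eq
    by (intro list_eqI_mem) simp
  moreover have "gates C = gates D"
  proof (rule list_eqI_mem)
    fix t g
    show "t < length (gates C) \<and> gates C ! t = g \<longleftrightarrow> t < length (gates D) \<and> gates D ! t = g"
      using gate_code_mem[of t "fst g" "snd g" C] gate_code_mem[of t "fst g" "snd g" D] eq by simp
  qed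
  moreover have "out_wire C = out_wire D"
    using out_code_mem[of "out_wire C" C] out_code_mem[of "out_wire C" D] eq by simp
  ultimately show "C = D" by (simp add: circuit.expand)
qed


section \<open>\<open>CC\<close> and \<open>FCC\<close>\<close>

text \<open>
  The circuits for a relation with \<open>k\<close> number and \<open>l\<close> string arguments form a family indexed by
  the \<open>k\<close> numbers followed by the lengths of the \<open>l\<close> strings; these indices are (unary) number
  arguments of the \<open>FAC\<^sup>0\<close> function that outputs the circuit.
\<close>

definition CC :: "nat \<Rightarrow> nat \<Rightarrow> relation set" where
  "CC k l = {R. \<exists>C :: nat list \<Rightarrow> circuit.
     (\<lambda>ys _. circuit_code (C ys)) \<in> FAC0 (k + l) 0 \<and>
     (\<exists>p :: nat poly. \<forall>ys. length ys = k + l \<longrightarrow> circuit_size (C ys) \<le> poly p (sum_list ys)) \<and>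
     (\<forall>xs ns. length xs = k \<longrightarrow> length ns = l \<longrightarrow> circuit_ok ns (C (xs @ ns))) \<and>
     (\<forall>xs Xs. length xs = k \<longrightarrow> length Xs = l \<longrightarrow>
        (R xs Xs \<longleftrightarrow> circuit_val (C (xs @ map slen Xs)) Xs))}"

definition FCC :: "(str \<Rightarrow> str) set" where
  "FCC = {F. (\<lambda>_ Xs. F (hd Xs)) \<in> function_class CC 0 1}"

end

(*
  The string G(X) is not at hand and its length m is not determined by the length of X, so the
  circuit C(i,m) for the i-th bit of F cannot be chosen in advance. Instead, all lengths m up to the
  polynomial bound on |G(X)| are tried: F(G(X))(i) holds iff for some m the bits of G(X) show that
  |G(X)| = m and C(i,m) accepts G(X). Every literal of this statement is computed by its own copy of
  a circuit for a bit of G, which is dualized if the literal is negative; no output has to be copied.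
  Feeding a uniform family of circuits into the wires of another circuit keeps uniformity once the
  copies are padded to equal size, because then wire and gate numbers are found by division with
  remainder.
*)
theory Submission
  imports Defs
begin

text \<open>Comparator gates are monotone and have no fan-out, whereas an input bit may annotate any
  number of wires, with or without negation. So everything is organised around
  \<open>cc_rel\<close>: relations between a string and a valuation of number variables that have
  uniform circuits. They are closed under negation, definable case distinction and bounded number
  quantifiers, so a relation is placed in the class by writing it as a formula. One construction,
  \<open>cc_rel_plug\<close>, yields both the quantifiers (the outer circuit is a chain of ORs) and
  the run of the circuit for \<open>F\<close> (the outer circuit is that circuit).

  Uniformity is treated in the same style. A circuit family counts as uniform if the lengths and
  entries of its two lists, coded by numbers, and its output wire are functions with a definable
  graph and a term bound (\<open>ac0_fun\<close>). The bound permits naming a value by a bounded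
  quantifier, which gives closure under substitution. Since terms are monotone, it also gives a
  bound valid for all wires at once, from which the common size of the copies is taken.\<close>

section \<open>Uniform number functions\<close>

text \<open>
  Circuit families are indexed by numbers only, so formulas are evaluated with all strings empty.
  Binding a variable conses a value in front of the valuation \<open>v\<close>; hence \<open>f (v 0) (tail v)\<close> is a
  function of one more variable than \<open>v\<close>.
\<close>

abbreviation (input) tail :: "(nat \<Rightarrow> nat) \<Rightarrow> nat \<Rightarrow> nat" where
  "tail v \<equiv> \<lambda>i. v (Suc i)"

section \<open>Polynomial terms and bounded formulas over numbers\<close>

definition term_fun :: "((nat \<Rightarrow> nat) \<Rightarrow> nat) \<Rightarrow> bool" where
  "term_fun f \<longleftrightarrow> (\<exists>t. \<forall>v. f v = trm_val v (\<lambda>_. {||}) t)"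

definition definable :: "((nat \<Rightarrow> nat) \<Rightarrow> bool) \<Rightarrow> bool" where
  "definable P \<longleftrightarrow> (\<exists>\<phi>. \<forall>v. P v \<longleftrightarrow> fm_val v (\<lambda>_. {||}) \<phi>)"

lemma term_fun_trm_val: "term_fun (\<lambda>v. trm_val v (\<lambda>_. {||}) t)"
  unfolding term_fun_def by blast

lemma definable_fm_val: "definable (\<lambda>v. fm_val v (\<lambda>_. {||}) \<phi>)"
  unfolding definable_def by blast

lemma term_fun_var: "term_fun (\<lambda>v. v i)"
  unfolding term_fun_def by (rule exI[of _ "NVar i"]) simp

lemma term_fun_add: "term_fun f \<Longrightarrow> term_fun g \<Longrightarrow> term_fun (\<lambda>v. f v + g v)"
  unfolding term_fun_def by (metis trm_val.simps(4))

lemma term_fun_mult: "term_fun f \<Longrightarrow> term_fun g \<Longrightarrow> term_fun (\<lambda>v. f v * g v)"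
  unfolding term_fun_def by (metis trm_val.simps(5))

lemma term_fun_const: "term_fun (\<lambda>_. c)"
proof (induction c)
  case 0
  show ?case unfolding term_fun_def by (rule exI[of _ Zero]) simp
next
  case (Suc c)
  have "term_fun (\<lambda>_. 1)" unfolding term_fun_def by (rule exI[of _ One]) simp
  from term_fun_add[OF Suc this] show ?case by simp
qed

lemma term_fun_subst:
  assumes "term_fun f" and "\<And>i. term_fun (g i)"
  shows "term_fun (\<lambda>v. f (\<lambda>i. g i v))"
proof -
  have "term_fun (\<lambda>v. trm_val (\<lambda>i. g i v) (\<lambda>_. {||}) t)" for t
    using assms(2)
    by (induction t) (auto simp: slen_def intro: term_fun_add term_fun_mult term_fun_const)
  then show ?thesis using assms(1) unfolding term_fun_def by auto
qed

lemma term_fun_poly: "term_fun f \<Longrightarrow> term_fun (\<lambda>v. poly p (f v))"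
  by (induction p) (auto intro: term_fun_add term_fun_mult term_fun_const)

text \<open>Terms are built from sums and products of natural numbers only. Monotonicity lets a
  bound on an argument be substituted into a bound on a value.\<close>

lemma term_fun_mono:
  assumes "term_fun f" and "\<And>i. u i \<le> v i"
  shows "f u \<le> f v"
proof -
  have "trm_val u s t \<le> trm_val v s t" for s t
    using assms(2) by (induction t) (auto intro: add_mono mult_le_mono)
  then show ?thesis using assms(1) unfolding term_fun_def by auto
qed

text \<open>Turns term bounds into polynomials in a single number, which will be the sum of the
  index list of a circuit family.\<close>

lemma term_fun_le_poly:
  assumes "term_fun f"
  shows "\<exists>p :: nat poly. \<forall>v b. (\<forall>i. v i \<le> b) \<longrightarrow> f v \<le> poly p b"
proof -
  have "\<exists>p :: nat poly. \<forall>v b. (\<forall>i. v i \<le> b) \<longrightarrow> trm_val v (\<lambda>_. {||}) t \<le> poly p b" for t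
  proof (induction t)
    case (NVar i)
    show ?case by (rule exI[of _ "[:0, 1:]"]) simp
  next
    case Zero
    show ?case by simp
  next
    case One
    show ?case by (rule exI[of _ 1]) simp
  next
    case (Plus t u)
    then obtain p q :: "nat poly"
      where "\<forall>v b. (\<forall>i. v i \<le> b) \<longrightarrow> trm_val v (\<lambda>_. {||}) t \<le> poly p b"
        and "\<forall>v b. (\<forall>i. v i \<le> b) \<longrightarrow> trm_val v (\<lambda>_. {||}) u \<le> poly q b" by blast
    then show ?case by (intro exI[of _ "p + q"]) (auto intro: add_mono)
  next
    case (Times t u)
    then obtain p q :: "nat poly"
      where "\<forall>v b. (\<forall>i. v i \<le> b) \<longrightarrow> trm_val v (\<lambda>_. {||}) t \<le> poly p b"
        and "\<forall>v b. (\<forall>i. v i \<le> b) \<longrightarrow> trm_val v (\<lambda>_. {||}) u \<le> poly q b" by blast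
    then show ?case by (intro exI[of _ "p * q"]) (auto intro: mult_le_mono)
  next
    case (Len j)
    show ?case by (simp add: slen_def)
  qed
  then show ?thesis using assms unfolding term_fun_def by metis
qed

lemma definable_term_eq: "term_fun f \<Longrightarrow> term_fun g \<Longrightarrow> definable (\<lambda>v. f v = g v)"
  unfolding term_fun_def definable_def by (metis fm_val.simps(1))

lemma definable_term_le: "term_fun f \<Longrightarrow> term_fun g \<Longrightarrow> definable (\<lambda>v. f v \<le> g v)"
  unfolding term_fun_def definable_def by (metis fm_val.simps(2))

lemma definable_not: "definable P \<Longrightarrow> definable (\<lambda>v. \<not> P v)"
  unfolding definable_def by (metis fm_val.simps(5))

lemma definable_conj: "definable P \<Longrightarrow> definable Q \<Longrightarrow> definable (\<lambda>v. P v \<and> Q v)"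
  unfolding definable_def by (metis fm_val.simps(6))

lemma definable_disj: "definable P \<Longrightarrow> definable Q \<Longrightarrow> definable (\<lambda>v. P v \<or> Q v)"
  unfolding definable_def by (metis fm_val.simps(7))

lemma definable_const: "definable (\<lambda>_. b)"
proof -
  have "definable (\<lambda>v. (if b then 0 else 1) = (0::nat))"
    by (intro definable_term_eq term_fun_const)
  then show ?thesis by (cases b) auto
qed

lemma definable_term_ex:
  assumes "term_fun f" and "definable (\<lambda>v. P (v 0) (tail v))"
  shows "definable (\<lambda>v. \<exists>y \<le> f v. P y v)"
proof -
  obtain t where t: "\<forall>v. f v = trm_val v (\<lambda>_. {||}) t"
    using assms(1) unfolding term_fun_def by blast
  obtain \<phi> where "\<forall>v. P (v 0) (tail v) \<longleftrightarrow> fm_val v (\<lambda>_. {||}) \<phi>"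
    using assms(2) unfolding definable_def by blast
  from this[rule_format, of "case_nat y v" for y v]
  have "fm_val (case_nat y v) (\<lambda>_. {||}) \<phi> \<longleftrightarrow> P y v" for y v by simp
  with t show ?thesis unfolding definable_def by (intro exI[of _ "BEx t \<phi>"]) simp
qed

lemma definable_term_all:
  assumes "term_fun f" and "definable (\<lambda>v. P (v 0) (tail v))"
  shows "definable (\<lambda>v. \<forall>y \<le> f v. P y v)"
  using definable_not[OF definable_term_ex[OF assms(1), of "\<lambda>y v. \<not> P y v"]] definable_not[OF assms(2)]
  by simp

text \<open>Substitution of terms comes before substitution of arbitrary uniform functions: it
  already provides weakening and renaming of variables, with which the closure properties of
  \<open>ac0_fun\<close> behind the general version are proved.\<close>

lemma definable_term_subst:
  assumes "definable P" and "\<And>i. term_fun (g i)"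
  shows "definable (\<lambda>v. P (\<lambda>i. g i v))"
proof -
  have "definable (\<lambda>v. fm_val (\<lambda>i. g i v) (\<lambda>_. {||}) \<phi>)" for \<phi>
    using assms(2)
  proof (induction \<phi> arbitrary: g)
    case (NEq t u)
    then show ?case
      using term_fun_subst[OF term_fun_trm_val] by (simp add: definable_term_eq)
  next
    case (NLe t u)
    then show ?case
      using term_fun_subst[OF term_fun_trm_val] by (simp add: definable_term_le)
  next
    case (BEx t \<phi>)
    \<comment> \<open>The substitution lifted under the binder: the bound variable is kept, all
      other terms read the shifted valuation.\<close>
    let ?g = "case_nat (\<lambda>v. v 0) (\<lambda>j v. g j (tail v))"
    have "term_fun (?g i)" for i
      by (cases i) (auto intro: term_fun_var term_fun_subst[OF BEx.prems])
    moreover have "(\<lambda>i. ?g i v) = case_nat (v 0) (\<lambda>i. g i (tail v))" for v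
      by (simp add: fun_eq_iff split: nat.split)
    ultimately have "definable (\<lambda>v. fm_val (case_nat (v 0) (\<lambda>i. g i (tail v))) (\<lambda>_. {||}) \<phi>)"
      using BEx.IH[of ?g] by simp
    then show ?case
      using definable_term_ex[OF term_fun_subst[OF term_fun_trm_val BEx.prems]] by simp
  next
    case (BAll t \<phi>)
    let ?g = "case_nat (\<lambda>v. v 0) (\<lambda>j v. g j (tail v))"
    have "term_fun (?g i)" for i
      by (cases i) (auto intro: term_fun_var term_fun_subst[OF BAll.prems])
    moreover have "(\<lambda>i. ?g i v) = case_nat (v 0) (\<lambda>i. g i (tail v))" for v
      by (simp add: fun_eq_iff split: nat.split)
    ultimately have "definable (\<lambda>v. fm_val (case_nat (v 0) (\<lambda>i. g i (tail v))) (\<lambda>_. {||}) \<phi>)"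
      using BAll.IH[of ?g] by simp
    then show ?case
      using definable_term_all[OF term_fun_subst[OF term_fun_trm_val BAll.prems]] by simp
  \<comment> \<open>The remaining atoms \<open>SEq\<close> and \<open>Bit\<close> are constant
    because all strings are empty.\<close>
  qed (auto intro: definable_not definable_conj definable_disj definable_const)
  then show ?thesis using assms(1) unfolding definable_def by auto
qed

lemma definable_term_subst_bound:
  assumes "definable (\<lambda>v. P (v 0) (tail v))" and "term_fun f" and "\<And>i. term_fun (g i)"
  shows "definable (\<lambda>v. P (f v) (\<lambda>i. g i v))"
proof -
  have "term_fun (case_nat f g i)" for i using assms(2,3) by (cases i) auto
  from definable_term_subst[where g = "case_nat f g", OF assms(1) this] show ?thesis by simp
qed

section \<open>Number functions with definable graph and polynomial bound\<close>

text \<open>The graph has the value at variable \<open>0\<close> and the arguments behind it. The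
  term bound is there so that a value can be introduced by a bounded quantifier.\<close>

definition ac0_fun :: "((nat \<Rightarrow> nat) \<Rightarrow> nat) \<Rightarrow> bool" where
  "ac0_fun f \<longleftrightarrow> (\<exists>b. term_fun b \<and> (\<forall>v. f v \<le> b v)) \<and> definable (\<lambda>v. v 0 = f (tail v))"

lemma ac0_funI:
  "term_fun b \<Longrightarrow> (\<And>v. f v \<le> b v) \<Longrightarrow> definable (\<lambda>v. v 0 = f (tail v)) \<Longrightarrow> ac0_fun f"
  unfolding ac0_fun_def by blast

lemma ac0_fun_graph: "ac0_fun f \<Longrightarrow> definable (\<lambda>v. v 0 = f (tail v))"
  unfolding ac0_fun_def by blast

lemma ac0_fun_bound: "ac0_fun f \<Longrightarrow> \<exists>b. term_fun b \<and> (\<forall>v. f v \<le> b v)"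
  unfolding ac0_fun_def by blast

lemma ac0_fun_term: "term_fun f \<Longrightarrow> ac0_fun f"
  by (rule ac0_funI[of f], assumption, simp, rule definable_term_eq[OF term_fun_var],
      erule term_fun_subst, rule term_fun_var)

lemma ac0_fun_var: "ac0_fun (\<lambda>v. v i)"
  by (rule ac0_fun_term[OF term_fun_var])

lemma ac0_fun_const: "ac0_fun (\<lambda>_. c)"
  by (rule ac0_fun_term[OF term_fun_const])

lemma definable_tail: "definable P \<Longrightarrow> definable (\<lambda>v. P (tail v))"
  by (rule definable_term_subst) (auto intro: term_fun_var)

lemma ac0_fun_tail:
  assumes "ac0_fun f"
  shows "ac0_fun (\<lambda>v. f (tail v))"
proof -
  obtain b where b: "term_fun b" "\<And>v. f v \<le> b v" using ac0_fun_bound[OF assms] by blast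
  have "definable (\<lambda>v. v 0 = f (\<lambda>i. v (Suc (Suc i))))"
    by (rule definable_term_subst_bound[OF ac0_fun_graph[OF assms]]) (rule term_fun_var)+
  with b show ?thesis
    by (intro ac0_funI[of "\<lambda>v. b (tail v)"] term_fun_subst[OF b(1)] term_fun_var) auto
qed

text \<open>The value of \<open>f\<close> is named by a quantifier that ranges up to its term
  bound.\<close>

lemma definable_let:
  assumes "ac0_fun f" and "definable (\<lambda>v. Q (v 0) (tail v))"
  shows "definable (\<lambda>v. Q (f v) v)"
proof -
  obtain b where b: "term_fun b" "\<And>v. f v \<le> b v" using ac0_fun_bound[OF assms(1)] by blast
  have "definable (\<lambda>v. \<exists>y \<le> b v. y = f v \<and> Q y v)"
    by (intro definable_term_ex b definable_conj ac0_fun_graph assms)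
  moreover have "(\<exists>y \<le> b v. y = f v \<and> Q y v) \<longleftrightarrow> Q (f v) v" for v using b(2) by auto
  ultimately show ?thesis by simp
qed

lemma definable_let2:
  assumes "ac0_fun f" and "ac0_fun g"
    and "definable (\<lambda>v. Q (v 1) (v 0) (\<lambda>i. v (Suc (Suc i))))"
  shows "definable (\<lambda>v. Q (f v) (g v) v)"
  by (rule definable_let[OF assms(1), of "\<lambda>y v. Q y (g v) v"],
      rule definable_let[OF ac0_fun_tail[OF assms(2)], of "\<lambda>z v. Q (v 0) z (tail v)"])
    (use assms(3) in simp)

lemma definable_eq: "ac0_fun f \<Longrightarrow> ac0_fun g \<Longrightarrow> definable (\<lambda>v. f v = g v)"
  by (rule definable_let2[of f g "\<lambda>y z _. y = z"]) (auto intro: definable_term_eq term_fun_var)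

lemma definable_le: "ac0_fun f \<Longrightarrow> ac0_fun g \<Longrightarrow> definable (\<lambda>v. f v \<le> g v)"
  by (rule definable_let2[of f g "\<lambda>y z _. y \<le> z"]) (auto intro: definable_term_le term_fun_var)

lemma definable_less: "ac0_fun f \<Longrightarrow> ac0_fun g \<Longrightarrow> definable (\<lambda>v. f v < g v)"
  using definable_not[OF definable_le[of g f]] by (simp add: not_le)

text \<open>Formulas admit only terms as quantifier bounds; naming the bound first turns it into a
  variable.\<close>

lemma definable_ex:
  assumes "ac0_fun f" and "definable (\<lambda>v. P (v 0) (tail v))"
  shows "definable (\<lambda>v. \<exists>y \<le> f v. P y v)"
proof (rule definable_let[OF assms(1), of "\<lambda>b v. \<exists>y \<le> b. P y v"], rule definable_term_ex[OF term_fun_var])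
  show "definable (\<lambda>v. P (v 0) (\<lambda>i. v (Suc (Suc i))))"
    by (rule definable_term_subst_bound[OF assms(2)]) (rule term_fun_var)+
qed

lemma definable_all:
  assumes "ac0_fun f" and "definable (\<lambda>v. P (v 0) (tail v))"
  shows "definable (\<lambda>v. \<forall>y \<le> f v. P y v)"
  using definable_not[OF definable_ex[OF assms(1), of "\<lambda>y v. \<not> P y v"]] definable_not[OF assms(2)]
  by simp

lemma ac0_fun_add:
  assumes "ac0_fun f" and "ac0_fun g"
  shows "ac0_fun (\<lambda>v. f v + g v)"
proof -
  obtain b c where b: "term_fun b" "\<And>v. f v \<le> b v" and c: "term_fun c" "\<And>v. g v \<le> c v"
    using ac0_fun_bound[OF assms(1)] ac0_fun_bound[OF assms(2)] by blast
  have "definable (\<lambda>v. v 0 = f (tail v) + g (tail v))"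
    by (rule definable_let2[OF ac0_fun_tail[OF assms(1)] ac0_fun_tail[OF assms(2)],
          of "\<lambda>y z v. v 0 = y + z"])
      (intro definable_term_eq term_fun_add term_fun_var)
  then show ?thesis by (intro ac0_funI[of "\<lambda>v. b v + c v"] term_fun_add add_mono b c)
qed

lemma ac0_fun_mult:
  assumes "ac0_fun f" and "ac0_fun g"
  shows "ac0_fun (\<lambda>v. f v * g v)"
proof -
  obtain b c where b: "term_fun b" "\<And>v. f v \<le> b v" and c: "term_fun c" "\<And>v. g v \<le> c v"
    using ac0_fun_bound[OF assms(1)] ac0_fun_bound[OF assms(2)] by blast
  have "definable (\<lambda>v. v 0 = f (tail v) * g (tail v))"
    by (rule definable_let2[OF ac0_fun_tail[OF assms(1)] ac0_fun_tail[OF assms(2)],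
          of "\<lambda>y z v. v 0 = y * z"])
      (intro definable_term_eq term_fun_mult term_fun_var)
  then show ?thesis by (intro ac0_funI[of "\<lambda>v. b v * c v"] term_fun_mult mult_le_mono b c)
qed

text \<open>The induction is the one for terms, but terms now become uniform functions, so atoms and
  quantifier bounds need the versions for \<open>ac0_fun\<close>.\<close>

lemma definable_subst:
  assumes "definable P" and "\<And>i. ac0_fun (g i)"
  shows "definable (\<lambda>v. P (\<lambda>i. g i v))"
proof -
  have trm: "ac0_fun (\<lambda>v. trm_val (\<lambda>i. g i v) (\<lambda>_. {||}) t)" if "\<And>i. ac0_fun (g i)" for t g
    using that
    by (induction t) (auto simp: slen_def intro: ac0_fun_add ac0_fun_mult ac0_fun_const)
  have "definable (\<lambda>v. fm_val (\<lambda>i. g i v) (\<lambda>_. {||}) \<phi>)" for \<phi>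
    using assms(2)
  proof (induction \<phi> arbitrary: g)
    case (BEx t \<phi>)
    let ?g = "case_nat (\<lambda>v. v 0) (\<lambda>j v. g j (tail v))"
    have "ac0_fun (?g i)" for i
      by (cases i) (auto intro: ac0_fun_var ac0_fun_tail[OF BEx.prems])
    moreover have "(\<lambda>i. ?g i v) = case_nat (v 0) (\<lambda>i. g i (tail v))" for v
      by (simp add: fun_eq_iff split: nat.split)
    ultimately have "definable (\<lambda>v. fm_val (case_nat (v 0) (\<lambda>i. g i (tail v))) (\<lambda>_. {||}) \<phi>)"
      using BEx.IH[of ?g] by simp
    then show ?case using definable_ex[OF trm[OF BEx.prems]] by simp
  next
    case (BAll t \<phi>)
    let ?g = "case_nat (\<lambda>v. v 0) (\<lambda>j v. g j (tail v))"
    have "ac0_fun (?g i)" for i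
      by (cases i) (auto intro: ac0_fun_var ac0_fun_tail[OF BAll.prems])
    moreover have "(\<lambda>i. ?g i v) = case_nat (v 0) (\<lambda>i. g i (tail v))" for v
      by (simp add: fun_eq_iff split: nat.split)
    ultimately have "definable (\<lambda>v. fm_val (case_nat (v 0) (\<lambda>i. g i (tail v))) (\<lambda>_. {||}) \<phi>)"
      using BAll.IH[of ?g] by simp
    then show ?case using definable_all[OF trm[OF BAll.prems]] by simp
  next
    case (NEq t u)
    then show ?case using definable_eq[OF trm trm] by simp
  next
    case (NLe t u)
    then show ?case using definable_le[OF trm trm] by simp
  qed (auto intro: definable_not definable_conj definable_disj definable_const)
  then show ?thesis using assms(1) unfolding definable_def by auto
qed

lemma definable_subst_bound:
  assumes "definable (\<lambda>v. P (v 0) (tail v))" and "ac0_fun f" and "\<And>i. ac0_fun (g i)"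
  shows "definable (\<lambda>v. P (f v) (\<lambda>i. g i v))"
proof -
  have "ac0_fun (case_nat f g i)" for i using assms(2,3) by (cases i) auto
  from definable_subst[where g = "case_nat f g", OF assms(1) this] show ?thesis by simp
qed

lemma ac0_fun_subst:
  assumes "ac0_fun f" and "\<And>i. ac0_fun (g i)"
  shows "ac0_fun (\<lambda>v. f (\<lambda>i. g i v))"
proof -
  obtain b where b: "term_fun b" "\<And>v. f v \<le> b v" using ac0_fun_bound[OF assms(1)] by blast
  obtain c where c: "\<And>i. term_fun (c i)" "\<And>i v. g i v \<le> c i v"
    using ac0_fun_bound[OF assms(2)] by metis
  have "definable (\<lambda>v. v 0 = f (\<lambda>i. g i (tail v)))"
    by (rule definable_subst_bound[OF ac0_fun_graph[OF assms(1)]])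
      (intro ac0_fun_var ac0_fun_tail assms(2))+
  \<comment> \<open>The term bound of \<open>f\<close> is monotone, so it may be evaluated at the
    term bounds of the inner functions.\<close>
  moreover have "f (\<lambda>i. g i v) \<le> b (\<lambda>i. c i v)" for v
    by (rule order_trans[OF b(2) term_fun_mono[OF b(1) c(2)]])
  ultimately show ?thesis
    by (intro ac0_funI[where b = "\<lambda>v. b (\<lambda>i. c i v)"] term_fun_subst[where g = c, OF b(1) c(1)])
qed

lemma ac0_fun_subst_bound:
  assumes "ac0_fun (\<lambda>v. h (v 0) (tail v))" and "ac0_fun f" and "\<And>i. ac0_fun (g i)"
  shows "ac0_fun (\<lambda>v. h (f v) (\<lambda>i. g i v))"
proof -
  have "ac0_fun (case_nat f g i)" for i using assms(2,3) by (cases i) auto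
  from ac0_fun_subst[where g = "case_nat f g", OF assms(1) this] show ?thesis by simp
qed

lemma ac0_fun_let:
  "ac0_fun (\<lambda>v. h (v 0) (tail v)) \<Longrightarrow> ac0_fun f \<Longrightarrow> ac0_fun (\<lambda>v. h (f v) v)"
  by (rule ac0_fun_subst_bound[where g = "\<lambda>i v. v i"]) (auto intro: ac0_fun_var)

text \<open>A bound of \<open>k\<close> is substituted for the first variable in a term bound of
  \<open>h\<close>, which is sound by monotonicity. This yields one size for a whole range of
  circuits.\<close>

lemma ac0_fun_uniform_bound:
  assumes "ac0_fun (\<lambda>v. h (v 0) (tail v))" and "ac0_fun k"
  shows "\<exists>b. term_fun b \<and> (\<forall>v. \<forall>w \<le> k v. h w v \<le> b v)"
proof -
  obtain b where b: "term_fun b" "\<And>v. h (v 0) (tail v) \<le> b v"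
    using ac0_fun_bound[OF assms(1)] by blast
  obtain c where c: "term_fun c" "\<And>v. k v \<le> c v" using ac0_fun_bound[OF assms(2)] by blast
  have "term_fun (case_nat c (\<lambda>j v. v j) i)" for i
    by (cases i) (auto intro: term_fun_var c)
  from term_fun_subst[where g = "case_nat c (\<lambda>j v. v j)", OF b(1) this] have "term_fun (\<lambda>v. b (\<lambda>i. case_nat c (\<lambda>j v. v j) i v))" .
  moreover have "h w v \<le> b (\<lambda>i. case_nat c (\<lambda>j v. v j) i v)" if "w \<le> k v" for v w
  proof -
    have "h w v \<le> b (case_nat w v)" using b(2)[of "case_nat w v"] by simp
    also have "\<dots> \<le> b (\<lambda>i. case_nat c (\<lambda>j v. v j) i v)"
      using that c(2)[of v] by (intro term_fun_mono[OF b(1)]) (simp split: nat.split)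
    finally show ?thesis .
  qed
  ultimately show ?thesis by blast
qed

lemma ac0_fun_if:
  assumes "definable P" and "ac0_fun f" and "ac0_fun g"
  shows "ac0_fun (\<lambda>v. if P v then f v else g v)"
proof -
  obtain b c where b: "term_fun b" "\<And>v. f v \<le> b v" and c: "term_fun c" "\<And>v. g v \<le> c v"
    using ac0_fun_bound[OF assms(2)] ac0_fun_bound[OF assms(3)] by blast
  have "definable (\<lambda>v. P (tail v) \<and> v 0 = f (tail v) \<or> \<not> P (tail v) \<and> v 0 = g (tail v))"
    by (intro definable_disj definable_conj definable_not definable_tail ac0_fun_graph assms)
  then have "definable (\<lambda>v. v 0 = (if P (tail v) then f (tail v) else g (tail v)))"
    by (rule back_subst[of definable]) auto
  with b c show ?thesis
    by (intro ac0_funI[of "\<lambda>v. b v + c v"] term_fun_add) (auto intro: trans_le_add1 trans_le_add2)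
qed

lemma ac0_fun_diff:
  assumes "ac0_fun f" and "ac0_fun g"
  shows "ac0_fun (\<lambda>v. f v - g v)"
proof -
  obtain b where b: "term_fun b" "\<And>v. f v \<le> b v" using ac0_fun_bound[OF assms(1)] by blast
  have "definable (\<lambda>v. f (tail v) = v 0 + g (tail v) \<or> f (tail v) < g (tail v) \<and> v 0 = 0)"
    by (intro definable_disj definable_conj definable_eq definable_less ac0_fun_add
        assms[THEN ac0_fun_tail] ac0_fun_var ac0_fun_const)
  then have "definable (\<lambda>v. v 0 = f (tail v) - g (tail v))"
    by (rule back_subst[of definable]) auto
  with b show ?thesis by (intro ac0_funI[of b]) (auto intro: order_trans[OF diff_le_self])
qed

section \<open>Division and pairing\<close>

lemma ac0_fun_div:
  assumes "ac0_fun f" and "ac0_fun g"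
  shows "ac0_fun (\<lambda>v. f v div g v)"
proof -
  obtain b where b: "term_fun b" "\<And>v. f v \<le> b v" using ac0_fun_bound[OF assms(1)] by blast
  \<comment> \<open>The first disjunct reflects that division by \<open>0\<close> gives
    \<open>0\<close>; the second is then unsatisfiable.\<close>
  have "definable (\<lambda>v. g (tail v) = 0 \<and> v 0 = 0 \<or>
      v 0 * g (tail v) \<le> f (tail v) \<and> f (tail v) < (v 0 + 1) * g (tail v))"
    by (intro definable_disj definable_conj definable_eq definable_less definable_le ac0_fun_add
        ac0_fun_mult assms[THEN ac0_fun_tail] ac0_fun_var ac0_fun_const)
  moreover have "(n = 0 \<and> y = 0 \<or> y * n \<le> m \<and> m < (y + 1) * n) \<longleftrightarrow> y = m div n" for y m n :: nat
    using dividend_less_times_div[of n m]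
    by (cases "n = 0") (auto simp: mult.commute intro: div_nat_eqI[symmetric])
  ultimately have "definable (\<lambda>v. v 0 = f (tail v) div g (tail v))" by simp
  with b show ?thesis by (intro ac0_funI[of b]) (auto intro: order_trans[OF div_le_dividend])
qed

lemma ac0_fun_mod:
  assumes "ac0_fun f" and "ac0_fun g"
  shows "ac0_fun (\<lambda>v. f v mod g v)"
  unfolding modulo_nat_def by (intro ac0_fun_diff ac0_fun_mult ac0_fun_div assms)

lemma ac0_fun_prod_encode:
  "ac0_fun f \<Longrightarrow> ac0_fun g \<Longrightarrow> ac0_fun (\<lambda>v. prod_encode (f v, g v))"
  unfolding prod_encode_def triangle_def Suc_eq_plus1 prod.case
  by (intro ac0_fun_add ac0_fun_mult ac0_fun_div ac0_fun_const)

text \<open>The components of a pair are at most its code, so pairing is inverted by a bounded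
  search.\<close>

lemma ac0_fun_fst_prod_decode:
  assumes "ac0_fun f"
  shows "ac0_fun (\<lambda>v. fst (prod_decode (f v)))"
proof -
  have "definable (\<lambda>v. \<exists>z \<le> v 1. prod_encode (v 0, z) = v 1)"
    by (intro definable_ex definable_eq ac0_fun_prod_encode ac0_fun_var)
  moreover have "(\<exists>z \<le> x. prod_encode (y, z) = x) \<longleftrightarrow> y = fst (prod_decode x)" for x y
    by (metis le_prod_encode_2 prod.collapse prod_decode_inverse prod_encode_inverse fst_conv)
  ultimately have "definable (\<lambda>v. v 0 = fst (prod_decode (v 1)))" by simp
  moreover have "fst (prod_decode x) \<le> x" for x
    by (metis le_prod_encode_1 prod.collapse prod_decode_inverse)
  ultimately have "ac0_fun (\<lambda>v. fst (prod_decode (v 0)))"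
    by (intro ac0_funI[of "\<lambda>v. v 0"] term_fun_var) auto
  from ac0_fun_let[OF this assms] show ?thesis .
qed

lemma ac0_fun_snd_prod_decode:
  assumes "ac0_fun f"
  shows "ac0_fun (\<lambda>v. snd (prod_decode (f v)))"
proof -
  have "definable (\<lambda>v. \<exists>z \<le> v 1. prod_encode (z, v 0) = v 1)"
    by (intro definable_ex definable_eq ac0_fun_prod_encode ac0_fun_var)
  moreover have "(\<exists>z \<le> x. prod_encode (z, y) = x) \<longleftrightarrow> y = snd (prod_decode x)" for x y
    by (metis le_prod_encode_1 prod.collapse prod_decode_inverse prod_encode_inverse snd_conv)
  ultimately have "definable (\<lambda>v. v 0 = snd (prod_decode (v 1)))" by simp
  moreover have "snd (prod_decode x) \<le> x" for x
    by (metis le_prod_encode_2 prod.collapse prod_decode_inverse)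
  ultimately have "ac0_fun (\<lambda>v. snd (prod_decode (v 0)))"
    by (intro ac0_funI[of "\<lambda>v. v 0"] term_fun_var) auto
  from ac0_fun_let[OF this assms] show ?thesis .
qed

section \<open>Circuit families given by lists of numbers\<close>

text \<open>Reading entries with default \<open>0\<close> makes the entry function total; the true
  length is recorded separately.\<close>

definition ac0_list :: "((nat \<Rightarrow> nat) \<Rightarrow> nat list) \<Rightarrow> bool" where
  "ac0_list xs \<longleftrightarrow> ac0_fun (\<lambda>v. length (xs v)) \<and> ac0_fun (\<lambda>v. nth_default 0 (xs (tail v)) (v 0))"

lemma ac0_fun_length: "ac0_list xs \<Longrightarrow> ac0_fun (\<lambda>v. length (xs v))"
  unfolding ac0_list_def by blast

lemma ac0_fun_nth_default:
  "ac0_list xs \<Longrightarrow> ac0_fun f \<Longrightarrow> ac0_fun (\<lambda>v. nth_default 0 (xs v) (f v))"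
  unfolding ac0_list_def
  by (rule ac0_fun_let[where h = "\<lambda>y v. nth_default 0 (xs v) y"]) blast+

lemma ac0_list_subst:
  assumes "ac0_list xs" and "\<And>i. ac0_fun (g i)"
  shows "ac0_list (\<lambda>v. xs (\<lambda>i. g i v))"
  unfolding ac0_list_def
proof
  show "ac0_fun (\<lambda>v. length (xs (\<lambda>i. g i v)))"
    by (rule ac0_fun_subst[OF ac0_fun_length[OF assms(1)] assms(2)])
  show "ac0_fun (\<lambda>v. nth_default 0 (xs (\<lambda>i. g i (tail v))) (v 0))"
    by (rule ac0_fun_subst_bound[where h = "\<lambda>y v. nth_default 0 (xs v) y" and g = "\<lambda>i v. g i (tail v)"])
      (use assms(1) in \<open>simp_all add: ac0_list_def ac0_fun_var ac0_fun_tail assms(2)\<close>)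
qed

lemma ac0_list_subst_bound:
  assumes "ac0_list (\<lambda>v. xs (v 0) (tail v))" and "ac0_fun f" and "\<And>i. ac0_fun (g i)"
  shows "ac0_list (\<lambda>v. xs (f v) (\<lambda>i. g i v))"
proof -
  have "ac0_fun (case_nat f g i)" for i using assms(2,3) by (cases i) auto
  from ac0_list_subst[where g = "case_nat f g", OF assms(1) this] show ?thesis by simp
qed

lemma ac0_list_map_upt:
  assumes "ac0_fun k" and "ac0_fun (\<lambda>v. f (v 0) (tail v))"
  shows "ac0_list (\<lambda>v. map (\<lambda>w. f w v) [0..<k v])"
proof -
  have "ac0_fun (\<lambda>v. if v 0 < k (tail v) then f (v 0) (tail v) else 0)"
    by (intro ac0_fun_if definable_less ac0_fun_var ac0_fun_tail[OF assms(1)] assms(2) ac0_fun_const)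
  moreover have "nth_default 0 (map (\<lambda>w. f w v) [0..<n]) i = (if i < n then f i v else 0)" for v n i
    by (simp add: nth_default_def)
  ultimately show ?thesis using assms(1) by (simp add: ac0_list_def)
qed

lemma ac0_list_map:
  assumes "ac0_list xs" and "ac0_fun (\<lambda>v. f (v 0) (tail v))"
  shows "ac0_list (\<lambda>v. map (\<lambda>x. f x v) (xs v))"
proof -
  have "ac0_fun (\<lambda>v. f (nth_default 0 (xs (tail v)) (v 0)) (tail v))"
    by (rule ac0_fun_subst_bound[OF assms(2)])
      (use assms(1) in \<open>auto simp: ac0_list_def intro: ac0_fun_var\<close>)
  from ac0_list_map_upt[where f = "\<lambda>w v. f (nth_default 0 (xs v) w) v", OF ac0_fun_length[OF assms(1)] this]
  have "ac0_list (\<lambda>v. map (\<lambda>w. f (nth_default 0 (xs v) w) v) [0..<length (xs v)])" .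
  moreover have "map (\<lambda>w. f (nth_default 0 (xs v) w) v) [0..<length (xs v)] = map (\<lambda>x. f x v) (xs v)"
    for v by (rule nth_equalityI) (auto simp: nth_default_def)
  ultimately show ?thesis by simp
qed

lemma ac0_list_append:
  assumes "ac0_list xs" and "ac0_list ys"
  shows "ac0_list (\<lambda>v. xs v @ ys v)"
proof -
  have "ac0_list (\<lambda>v. xs (tail v))" "ac0_list (\<lambda>v. ys (tail v))"
    using assms by (auto intro: ac0_list_subst ac0_fun_var)
  then have "ac0_fun (\<lambda>v. if v 0 < length (xs (tail v)) then nth_default 0 (xs (tail v)) (v 0)
      else nth_default 0 (ys (tail v)) (v 0 - length (xs (tail v))))"
    by (intro ac0_fun_if definable_less ac0_fun_var ac0_fun_nth_default ac0_fun_diff ac0_fun_length)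
  moreover have "nth_default 0 (as @ bs) i =
      (if i < length as then nth_default 0 as i else nth_default 0 bs (i - length as))" for as bs :: "nat list" and i
    by (simp add: nth_default_append nth_default_nth)
  ultimately show ?thesis
    using assms by (simp add: ac0_list_def ac0_fun_add)
qed

lemma concat_equal_length:
  assumes "\<And>w. w < W \<Longrightarrow> length (xs w) = S"
  shows "concat (map xs [0..<W]) = map (\<lambda>t. nth_default d (xs (t div S)) (t mod S)) [0..<W * S]"
  using assms
proof (induction W)
  case (Suc W)
  have len: "length (xs W) = S" using Suc.prems by simp
  have "[0..<Suc W * S] = [0..<W * S] @ [W * S..<W * S + S]"
    by (metis add.commute le_add2 mult_Suc upt_add_eq_append zero_le)
  moreover have "map (\<lambda>t. nth_default d (xs (t div S)) (t mod S)) [W * S..<W * S + S] = xs W"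
    by (rule nth_equalityI) (auto simp: len nth_default_def)
  ultimately show ?case using Suc by simp
qed simp

text \<open>With blocks of varying length the start of a block would be an iterated sum, which none
  of the closure properties above provides.\<close>

lemma ac0_list_concat:
  assumes "ac0_list (\<lambda>v. xs (v 0) (tail v))" and "ac0_fun W" and "ac0_fun S"
    and "\<And>v w. w < W v \<Longrightarrow> length (xs w v) = S v"
  shows "ac0_list (\<lambda>v. concat (map (\<lambda>w. xs w v) [0..<W v]))"
proof -
  have "ac0_list (\<lambda>v. xs (v 0 div S (tail v)) (tail v))"
    by (rule ac0_list_subst_bound[OF assms(1), where g = "\<lambda>i v. v (Suc i)"])
      (intro ac0_fun_div ac0_fun_var ac0_fun_tail[OF assms(3)])+
  then have "ac0_fun (\<lambda>v. nth_default 0 (xs (v 0 div S (tail v)) (tail v)) (v 0 mod S (tail v)))"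
    by (intro ac0_fun_nth_default ac0_fun_mod ac0_fun_var ac0_fun_tail[OF assms(3)])
  from ac0_list_map_upt[where f = "\<lambda>t v. nth_default 0 (xs (t div S v) v) (t mod S v)",
      OF ac0_fun_mult[OF assms(2,3)] this]
  show ?thesis using assms(4) by (simp add: concat_equal_length[where d = 0])
qed

lemma ac0_list_replicate:
  "ac0_fun k \<Longrightarrow> ac0_fun f \<Longrightarrow> ac0_list (\<lambda>v. replicate (k v) (f v))"
  using ac0_list_map_upt[of k "\<lambda>_. f"] by (simp add: ac0_fun_tail map_replicate_const)

lemma ac0_list_if:
  assumes "definable P" and "ac0_list xs" and "ac0_list ys"
  shows "ac0_list (\<lambda>v. if P v then xs v else ys v)"
proof -
  have "(\<lambda>v. length (if P v then xs v else ys v)) = (\<lambda>v. if P v then length (xs v) else length (ys v))"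
    and "(\<lambda>v. nth_default 0 (if P (tail v) then xs (tail v) else ys (tail v)) (v 0)) =
      (\<lambda>v. if P (tail v) then nth_default 0 (xs (tail v)) (v 0) else nth_default 0 (ys (tail v)) (v 0))"
    by auto
  then show ?thesis using assms
    by (simp add: ac0_list_def ac0_fun_if definable_tail)
qed

text \<open>A code string tells only which entry stands at which position. Length and entries are
  extracted from this relation by bounded search.\<close>

lemma ac0_listI_graph:
  assumes graph: "definable (\<lambda>v. v 0 < length (xs (\<lambda>i. v (Suc (Suc i)))) \<and>
      xs (\<lambda>i. v (Suc (Suc i))) ! v 0 = v 1)"
    and b: "term_fun b" "\<And>v. length (xs v) \<le> b v" "\<And>v x. x \<in> set (xs v) \<Longrightarrow> x \<le> b v"
  shows "ac0_list xs"
proof -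
  have "definable (\<lambda>v. (\<lambda>w v. w < length (xs (tail v)) \<and> xs (tail v) ! w = v 0) (v 0) (tail v))"
    using graph by simp
  from definable_subst_bound[where P = "\<lambda>w v. w < length (xs (tail v)) \<and> xs (tail v) ! w = v 0", OF this]
  have H: "definable (\<lambda>v. f v < length (xs (\<lambda>i. g (Suc i) v)) \<and> xs (\<lambda>i. g (Suc i) v) ! f v = g 0 v)"
    if "ac0_fun f" "\<And>i. ac0_fun (g i)" for f g using that by blast
  have H': "definable (\<lambda>v. f v < length (xs (\<lambda>i. g i v)) \<and> xs (\<lambda>i. g i v) ! f v = h v)"
    if "ac0_fun f" "ac0_fun h" "\<And>i. ac0_fun (g i)" for f h g
  proof -
    have "ac0_fun (case_nat h g i)" for i using that by (cases i) auto
    from H[OF that(1), where g = "case_nat h g", OF this] show ?thesis by simp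
  qed
  have bf: "ac0_fun b" using b(1) by (rule ac0_fun_term)
  have E: "definable (\<lambda>v. f v < length (xs (\<lambda>i. g i v)))"
    if f: "ac0_fun f" and g: "\<And>i. ac0_fun (g i)" for f g
  proof -
    have "definable (\<lambda>v. \<exists>c \<le> b (\<lambda>i. g i v). f v < length (xs (\<lambda>i. g i v)) \<and> xs (\<lambda>i. g i v) ! f v = c)"
      by (rule definable_ex[OF ac0_fun_subst[OF bf g]], rule H')
        (auto intro: ac0_fun_tail[OF f] ac0_fun_tail[OF g] ac0_fun_var)
    moreover have "(\<exists>c \<le> b u. w < length (xs u) \<and> xs u ! w = c) \<longleftrightarrow> w < length (xs u)" for u w
      using b(3)[OF nth_mem] by auto
    ultimately show ?thesis by simp
  qed
  show ?thesis unfolding ac0_list_def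
  proof
    \<comment> \<open>The length is the least position that carries no entry.\<close>
    have "definable (\<lambda>v. \<not> v 0 < length (xs (tail v)) \<and>
        (\<forall>w \<le> v 0. w = v 0 \<or> w < length (xs (tail v))))"
      by (intro definable_conj definable_not definable_all definable_disj definable_eq E ac0_fun_var)
    moreover have "(\<not> n < m \<and> (\<forall>w \<le> n. w = n \<or> w < m)) \<longleftrightarrow> n = m" for n m :: nat
      by (metis le_refl linorder_neqE_nat nat_less_le)
    ultimately show "ac0_fun (\<lambda>v. length (xs v))" using b by (intro ac0_funI[of b]) auto
    have "definable (\<lambda>v. v 1 < length (xs (\<lambda>i. v (Suc (Suc i)))) \<and>
        xs (\<lambda>i. v (Suc (Suc i))) ! v 1 = v 0 \<or>
        \<not> v 1 < length (xs (\<lambda>i. v (Suc (Suc i)))) \<and> v 0 = 0)"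
      by (intro definable_disj H' definable_conj definable_not E definable_eq ac0_fun_var ac0_fun_const)
    moreover have "(w < length ys \<and> ys ! w = y \<or> \<not> w < length ys \<and> y = 0) \<longleftrightarrow> y = nth_default 0 ys w"
      for w y :: nat and ys by (auto simp: nth_default_def)
    ultimately have "definable (\<lambda>v. v 0 = nth_default 0 (xs (\<lambda>i. v (Suc (Suc i)))) (v 1))" by simp
    moreover have "nth_default 0 (xs u) w \<le> b u" for u w
      using b(3)[OF nth_mem] by (simp add: nth_default_def)
    ultimately show "ac0_fun (\<lambda>v. nth_default 0 (xs (tail v)) (v 0))"
      by (intro ac0_funI[of "\<lambda>v. b (tail v)"] term_fun_subst[OF b(1)] term_fun_var) auto
  qed
qed

section \<open>Circuits as lists of numbers and their code strings\<close>

text \<open>The part of \<open>annotation_code\<close> that does not mention the wire, so that the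
  annotations of a circuit become a list of numbers.\<close>

primrec annotation_num :: "annotation \<Rightarrow> nat" where
  "annotation_num (PosIn j i) = prod_encode (0, prod_encode (j, i))"
| "annotation_num (NegIn j i) = prod_encode (1, prod_encode (j, i))"
| "annotation_num (Const b) = prod_encode (2, of_bool b)"

lemma annotation_code_num:
  "annotation_code w \<alpha> = prod_encode (0, prod_encode (w, annotation_num \<alpha>))"
  by (cases \<alpha>) (simp_all add: quad_encode_def)

text \<open>Uniformity of the code string, expressed through lists:
  \<open>definable_circuit_code\<close> and \<open>slen_circuit_code_bound\<close> lead from here to
  the string, \<open>ac0_circuitI_code\<close> leads back.\<close>

definition ac0_circuit :: "((nat \<Rightarrow> nat) \<Rightarrow> circuit) \<Rightarrow> bool" where
  "ac0_circuit C \<longleftrightarrow> ac0_list (\<lambda>v. map annotation_num (annots (C v))) \<and>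
     ac0_list (\<lambda>v. map prod_encode (gates (C v))) \<and> ac0_fun (\<lambda>v. out_wire (C v))"

lemma ac0_circuitI:
  "ac0_list (\<lambda>v. map annotation_num (annots (C v))) \<Longrightarrow>
   ac0_list (\<lambda>v. map prod_encode (gates (C v))) \<Longrightarrow> ac0_fun (\<lambda>v. out_wire (C v)) \<Longrightarrow> ac0_circuit C"
  unfolding ac0_circuit_def by blast

lemma ac0_circuitD:
  assumes "ac0_circuit C"
  shows "ac0_list (\<lambda>v. map annotation_num (annots (C v)))"
    and "ac0_list (\<lambda>v. map prod_encode (gates (C v)))" and "ac0_fun (\<lambda>v. out_wire (C v))"
    and "ac0_fun (\<lambda>v. length (annots (C v)))" and "ac0_fun (\<lambda>v. length (gates (C v)))"
  using assms unfolding ac0_circuit_def ac0_list_def by auto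

lemma ac0_circuit_subst:
  assumes "ac0_circuit C" and "\<And>i. ac0_fun (g i)"
  shows "ac0_circuit (\<lambda>v. C (\<lambda>i. g i v))"
  using ac0_list_subst[OF ac0_circuitD(1)[OF assms(1)] assms(2)]
    ac0_list_subst[OF ac0_circuitD(2)[OF assms(1)] assms(2)]
    ac0_fun_subst[OF ac0_circuitD(3)[OF assms(1)] assms(2)]
  by (rule ac0_circuitI)

lemma ac0_circuit_if:
  assumes "definable P" and "ac0_circuit C" and "ac0_circuit D"
  shows "ac0_circuit (\<lambda>v. if P v then C v else D v)"
  using ac0_list_if[OF assms(1) ac0_circuitD(1)[OF assms(2)] ac0_circuitD(1)[OF assms(3)]]
    ac0_list_if[OF assms(1) ac0_circuitD(2)[OF assms(2)] ac0_circuitD(2)[OF assms(3)]]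
    ac0_fun_if[OF assms(1) ac0_circuitD(3)[OF assms(2)] ac0_circuitD(3)[OF assms(3)]]
  by (intro ac0_circuitI) (simp_all only: if_distrib[of annots] if_distrib[of gates]
      if_distrib[of out_wire] if_distrib[of "map _"])

lemma ac0_circuit_const_circuit: "ac0_circuit (\<lambda>_. Circuit [Const b] [] 0)"
  using ac0_list_replicate[OF ac0_fun_const[of 1] ac0_fun_const]
    ac0_list_replicate[OF ac0_fun_const[of 0] ac0_fun_const] ac0_fun_const
  by (intro ac0_circuitI) auto

lemma slen_le_iff: "slen X \<le> b \<longleftrightarrow> (\<forall>x. x |\<in>| X \<longrightarrow> x < b)"
proof (cases "X = {||}")
  case False
  then have "fMax X < b" if "\<forall>x. x |\<in>| X \<longrightarrow> x < b" using that fMax_in by blast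
  moreover have "x < b" if "fMax X < b" "x |\<in>| X" for x using that fMax_ge le_less_trans by blast
  ultimately have "fMax X < b \<longleftrightarrow> (\<forall>x. x |\<in>| X \<longrightarrow> x < b)" by blast
  then show ?thesis by (simp only: slen_def False if_False Suc_le_eq)
qed (simp add: slen_def)

lemma circuit_code_iff:
  "x |\<in>| circuit_code C \<longleftrightarrow>
    (\<exists>w < length (annots C). x = prod_encode (0, prod_encode (w, nth_default 0 (map annotation_num (annots C)) w))) \<or>
    (\<exists>t < length (gates C). x = prod_encode (1, prod_encode (t, nth_default 0 (map prod_encode (gates C)) t))) \<or>
    x = prod_encode (2, prod_encode (0, prod_encode (0, out_wire C)))"
  by (auto simp: circuit_code_def fset_of_list_elem annotation_code_num quad_encode_def nth_default_def
      image_iff Bex_def)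

lemma definable_circuit_code:
  assumes "ac0_circuit C"
  shows "definable (\<lambda>v. v 0 |\<in>| circuit_code (C (tail v)))"
proof -
  note C = ac0_circuitD[OF assms]
  note t = ac0_list_subst[OF C(1) ac0_fun_var] ac0_list_subst[OF C(2) ac0_fun_var]
  have ex: "definable (\<lambda>v. \<exists>w < f v. P w v)"
    if "ac0_fun f" "definable (\<lambda>v. P (v 0) (tail v))" for f P
  proof -
    have "definable (\<lambda>v. \<exists>w \<le> f v. w < f v \<and> P w v)"
      by (intro definable_ex definable_conj definable_less ac0_fun_var that ac0_fun_tail[OF that(1)])
    then show ?thesis by (rule back_subst[of definable]) (auto intro: less_imp_le)
  qed
  show ?thesis unfolding circuit_code_iff
    by (intro definable_disj ex definable_eq ac0_fun_prod_encode ac0_fun_nth_default t ac0_fun_var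
        ac0_fun_const ac0_fun_tail[OF C(3)] ac0_fun_tail[OF C(4)] ac0_fun_tail[OF C(5)])
qed

lemma slen_circuit_code_bound:
  assumes "ac0_circuit C"
  shows "\<exists>b. term_fun b \<and> (\<forall>v. slen (circuit_code (C v)) \<le> b v)"
proof -
  note C = ac0_circuitD[OF assms]
  note t = ac0_list_subst[OF C(1) ac0_fun_var] ac0_list_subst[OF C(2) ac0_fun_var]
  let ?a = "\<lambda>w v. prod_encode (0, prod_encode (w, nth_default 0 (map annotation_num (annots (C v))) w))"
  let ?g = "\<lambda>w v. prod_encode (1, prod_encode (w, nth_default 0 (map prod_encode (gates (C v))) w))"
  let ?o = "\<lambda>v. prod_encode (2, prod_encode (0, prod_encode (0, out_wire (C v))))"
  have "ac0_fun (\<lambda>v. ?a (v 0) (tail v))"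
    by (intro ac0_fun_prod_encode ac0_fun_nth_default t ac0_fun_var ac0_fun_const)
  from ac0_fun_uniform_bound[where h = ?a, OF this C(4)]
  obtain a where a: "term_fun a" "\<And>v w. w \<le> length (annots (C v)) \<Longrightarrow> ?a w v \<le> a v" by blast
  have "ac0_fun (\<lambda>v. ?g (v 0) (tail v))"
    by (intro ac0_fun_prod_encode ac0_fun_nth_default t ac0_fun_var ac0_fun_const)
  from ac0_fun_uniform_bound[where h = ?g, OF this C(5)]
  obtain g where g: "term_fun g" "\<And>v w. w \<le> length (gates (C v)) \<Longrightarrow> ?g w v \<le> g v" by blast
  have "ac0_fun ?o" by (intro ac0_fun_prod_encode ac0_fun_const C)
  from ac0_fun_bound[OF this] obtain c where c: "term_fun c" "\<And>v. ?o v \<le> c v" by blast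
  \<comment> \<open>\<open>slen\<close> exceeds the largest position by one, hence the final
    \<open>1\<close>.\<close>
  have "term_fun (\<lambda>v. a v + g v + c v + 1)"
    by (intro term_fun_add a g c term_fun_const)
  moreover have "slen (circuit_code (C v)) \<le> a v + g v + c v + 1" for v
    unfolding slen_le_iff circuit_code_iff
    using a(2)[OF less_imp_le, of _ v] g(2)[OF less_imp_le, of _ v] c(2)[of v]
    by (fastforce simp: less_Suc_eq_le)
  ultimately show ?thesis by blast
qed

text \<open>The string contains the graphs of both lists. The components of a position never exceed
  it, so the length of the string bounds the lengths of the lists, their entries and the output
  wire.\<close>

lemma ac0_circuitI_code:
  assumes code: "definable (\<lambda>v. v 0 |\<in>| circuit_code (C (tail v)))"
    and b: "term_fun b" "\<And>v. slen (circuit_code (C v)) \<le> b v"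
  shows "ac0_circuit C"
proof (rule ac0_circuitI)
  have le: "x \<le> b v" if "x |\<in>| circuit_code (C v)" for x v
    using b(2)[of v] that unfolding slen_le_iff by (simp add: less_imp_le)
  have annot: "prod_encode (0, prod_encode (w, c)) |\<in>| circuit_code C \<longleftrightarrow>
      w < length (map annotation_num (annots C)) \<and> map annotation_num (annots C) ! w = c" for w c C
    by (auto simp: circuit_code_iff nth_default_def)
  have gate: "prod_encode (1, prod_encode (w, c)) |\<in>| circuit_code C \<longleftrightarrow>
      w < length (map prod_encode (gates C)) \<and> map prod_encode (gates C) ! w = c" for w c C
    by (auto simp: circuit_code_iff nth_default_def)
  have out: "prod_encode (2, prod_encode (0, prod_encode (0, c))) |\<in>| circuit_code C \<longleftrightarrow>
      c = out_wire C" for c C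
    by (auto simp: circuit_code_iff)
  have bnd: "w < b v" "c \<le> b v" if "prod_encode (k, prod_encode (w, c)) |\<in>| circuit_code (C v)" for k w c v
  proof -
    have "prod_encode (k, prod_encode (w, c)) < b v" using b(2)[of v] that unfolding slen_le_iff by simp
    then show "w < b v" "c \<le> b v"
      using le_prod_encode_2[of "prod_encode (w, c)" k] le_prod_encode_1[of w c] le_prod_encode_2[of c w]
      by linarith+
  qed
  have list: "ac0_list xs" if xs: "\<And>w c v. prod_encode (k, prod_encode (w, c)) |\<in>| circuit_code (C v) \<longleftrightarrow>
      w < length (xs v) \<and> xs v ! w = c" for k xs
  proof (rule ac0_listI_graph[OF _ b(1)])
    have "definable (\<lambda>v. prod_encode (k, prod_encode (v 0, v 1)) |\<in>| circuit_code (C (\<lambda>i. v (Suc (Suc i)))))"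
      by (rule definable_subst_bound[OF code]) (intro ac0_fun_prod_encode ac0_fun_const ac0_fun_var)+
    then show "definable (\<lambda>v. v 0 < length (xs (\<lambda>i. v (Suc (Suc i)))) \<and>
      xs (\<lambda>i. v (Suc (Suc i))) ! v 0 = v 1)" by (simp add: xs)
    \<comment> \<open>The last entry occurs in the code together with its position, which is
      therefore below the bound.\<close>
    show "length (xs v) \<le> b v" for v
      using bnd(1)[of k "length (xs v) - 1" _ v] xs by (cases "xs v") auto
    show "x \<le> b v" if "x \<in> set (xs v)" for x v
      using that bnd(2)[of k _ x v] xs by (metis in_set_conv_nth)
  qed
  show "ac0_list (\<lambda>v. map annotation_num (annots (C v)))" by (rule list[OF annot])
  show "ac0_list (\<lambda>v. map prod_encode (gates (C v)))" by (rule list[OF gate])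
  show "ac0_fun (\<lambda>v. out_wire (C v))"
  proof (rule ac0_funI[OF b(1)])
    show "out_wire (C v) \<le> b v" for v
      using le[of "prod_encode (2, prod_encode (0, prod_encode (0, out_wire (C v))))" v]
        le_prod_encode_2[of "prod_encode (0, prod_encode (0, out_wire (C v)))" 2]
        le_prod_encode_2[of "prod_encode (0, out_wire (C v))" 0]
        le_prod_encode_2[of "out_wire (C v)" 0] by (simp add: out)
    have "definable (\<lambda>v. prod_encode (2, prod_encode (0, prod_encode (0, v 0))) |\<in>| circuit_code (C (tail v)))"
      by (rule definable_subst_bound[OF code]) (intro ac0_fun_prod_encode ac0_fun_const ac0_fun_var)+
    then show "definable (\<lambda>v. v 0 = out_wire (C (tail v)))" by (simp add: out)
  qed
qed

section \<open>Duals, padding and composition of circuits\<close>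

text \<open>Total assignments replace lists of wire values, so that circuits can be relabelled and
  embedded into larger ones without tracking lengths.\<close>

fun compare :: "nat \<times> nat \<Rightarrow> (nat \<Rightarrow> bool) \<Rightarrow> nat \<Rightarrow> bool" where
  "compare (a, b) f = f(a := f a \<and> f b, b := f a \<or> f b)"

lemma fold_comparator_nth:
  assumes "\<And>a b. (a, b) \<in> set gs \<Longrightarrow> a < length vs \<and> b < length vs" and "i < length vs"
  shows "fold comparator gs vs ! i \<longleftrightarrow> fold compare gs (\<lambda>i. vs ! i) i"
proof -
  have "\<forall>i < length vs. fold comparator gs vs ! i \<longleftrightarrow> fold compare gs f i"
    if "\<And>i. i < length vs \<Longrightarrow> f i = vs ! i" for f
    using assms(1) that
  proof (induction gs arbitrary: vs f)
    case (Cons g gs)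
    obtain a b where g: "g = (a, b)" by (cases g)
    have "a < length vs" "b < length vs" using Cons.prems(1)[of a b] g by auto
    then have "compare g f i = comparator g vs ! i" if "i < length vs" for i
      using that Cons.prems(2) g by (auto simp: nth_list_update)
    moreover have "length (comparator g vs) = length vs" by (simp add: g)
    moreover have "a < length vs \<and> b < length vs" if "(a, b) \<in> set gs" for a b
      using Cons.prems(1)[of a b] that by simp
    ultimately show ?case using Cons.IH[of "comparator g vs" "compare g f"] by simp
  qed simp
  then show ?thesis using assms(2) by blast
qed

text \<open>Injectivity on the wires in use keeps them distinct, so a relabelled gate disturbs no
  other wire in use. Values of \<open>f\<close> outside the image of \<open>A\<close> are
  irrelevant.\<close>

lemma fold_compare_relabel:
  assumes "inj_on h A" and "\<And>a b. (a, b) \<in> set gs \<Longrightarrow> a \<in> A \<and> b \<in> A"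
    and "\<And>x. x \<in> A \<Longrightarrow> f (h x) = g x" and "x \<in> A"
  shows "fold compare (map (map_prod h h) gs) f (h x) \<longleftrightarrow> fold compare gs g x"
  using assms(2,3)
proof (induction gs arbitrary: f g)
  case (Cons e gs)
  obtain a b where e: "e = (a, b)" by (cases e)
  have ab: "a \<in> A" "b \<in> A" using Cons.prems(1)[of a b] e by auto
  have "compare (map_prod h h e) f (h x) = compare e g x" if "x \<in> A" for x
    using that ab Cons.prems(2) e inj_on_eq_iff[OF assms(1)] by auto
  moreover have "a \<in> A \<and> b \<in> A" if "(a, b) \<in> set gs" for a b
    using Cons.prems(1)[of a b] that by simp
  ultimately show ?case using Cons.IH[of "compare (map_prod h h e) f" "compare e g"] by simp
qed (use assms(4) in simp)

lemma fold_compare_cong: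
  assumes "\<And>a b. (a, b) \<in> set gs \<Longrightarrow> a \<in> A \<and> b \<in> A" and "\<And>x. x \<in> A \<Longrightarrow> f x = g x" and "x \<in> A"
  shows "fold compare gs f x \<longleftrightarrow> fold compare gs g x"
  using fold_compare_relabel[of id A gs f g x] assms by (simp add: map_prod.id)

lemma fold_compare_outside:
  assumes "\<And>a b. (a, b) \<in> set gs \<Longrightarrow> a \<noteq> y \<and> b \<noteq> y"
  shows "fold compare gs f y = f y"
  using assms
proof (induction gs arbitrary: f)
  case (Cons e gs)
  obtain a b where "e = (a, b)" by (cases e)
  with Cons.prems[of a b] have "compare e f y = f y" by auto
  moreover have "a \<noteq> y \<and> b \<noteq> y" if "(a, b) \<in> set gs" for a b
    using Cons.prems[of a b] that by simp
  ultimately show ?case using Cons.IH[of "compare e f"] by simp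
qed simp

lemma fold_compare_swap:
  "fold compare (map prod.swap gs) (\<lambda>i. \<not> f i) x \<longleftrightarrow> \<not> fold compare gs f x"
proof (induction gs arbitrary: f)
  case (Cons e gs)
  obtain a b where "e = (a, b)" by (cases e)
  then have "compare (prod.swap e) (\<lambda>i. \<not> f i) = (\<lambda>i. \<not> compare e f i)"
    by (auto simp: fun_eq_iff)
  then show ?case using Cons by simp
qed simp

text \<open>The part of \<open>circuit_ok\<close> that is independent of the input lengths: it is
  what an outer circuit has to satisfy when its annotations are replaced by other circuits.\<close>

definition wires_ok :: "circuit \<Rightarrow> bool" where
  "wires_ok C \<longleftrightarrow>
     (\<forall>(a, b) \<in> set (gates C). a < length (annots C) \<and> b < length (annots C) \<and> a \<noteq> b) \<and>
     out_wire C < length (annots C)"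

lemma circuit_ok_iff: "circuit_ok ns C \<longleftrightarrow> (\<forall>\<alpha> \<in> set (annots C). annotation_ok ns \<alpha>) \<and> wires_ok C"
  by (auto simp: circuit_ok_def wires_ok_def)

lemma wires_okD:
  assumes "wires_ok C"
  shows "(a, b) \<in> set (gates C) \<Longrightarrow> a < length (annots C)"
    and "(a, b) \<in> set (gates C) \<Longrightarrow> b < length (annots C)"
    and "(a, b) \<in> set (gates C) \<Longrightarrow> a \<noteq> b" and "out_wire C < length (annots C)"
  using assms unfolding wires_ok_def by auto

lemma circuit_val_compare:
  assumes "wires_ok C"
  shows "circuit_val C Xs \<longleftrightarrow>
    fold compare (gates C) (\<lambda>i. annotation_val Xs (annots C ! i)) (out_wire C)"
proof -
  let ?vs = "map (annotation_val Xs) (annots C)"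
  have "circuit_val C Xs \<longleftrightarrow> fold compare (gates C) (\<lambda>i. ?vs ! i) (out_wire C)"
    unfolding circuit_val_def using wires_okD[OF assms] by (intro fold_comparator_nth) auto
  also have "\<dots> \<longleftrightarrow> fold compare (gates C) (\<lambda>i. annotation_val Xs (annots C ! i)) (out_wire C)"
    using wires_okD[OF assms] by (intro fold_compare_cong[where A = "{..<length (annots C)}"]) auto
  finally show ?thesis .
qed

section \<open>Duals and padding\<close>

primrec negate_annotation :: "annotation \<Rightarrow> annotation" where
  "negate_annotation (PosIn j i) = NegIn j i"
| "negate_annotation (NegIn j i) = PosIn j i"
| "negate_annotation (Const b) = Const (\<not> b)"

text \<open>By De Morgan, exchanging the outputs of every gate and negating the inputs negates all wires.\<close>

definition dual_circuit :: "circuit \<Rightarrow> circuit" where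
  "dual_circuit C =
    Circuit (map negate_annotation (annots C)) (map prod.swap (gates C)) (out_wire C)"

lemma negate_annotation_val: "annotation_val Xs (negate_annotation \<alpha>) \<longleftrightarrow> \<not> annotation_val Xs \<alpha>"
  by (cases \<alpha>) auto

lemma negate_annotation_ok: "annotation_ok ns (negate_annotation \<alpha>) \<longleftrightarrow> annotation_ok ns \<alpha>"
  by (cases \<alpha>) auto

lemma dual_circuit_ok: "circuit_ok ns C \<Longrightarrow> circuit_ok ns (dual_circuit C)"
  unfolding circuit_ok_def dual_circuit_def by (fastforce simp: negate_annotation_ok)

lemma dual_circuit_val:
  assumes "wires_ok C"
  shows "circuit_val (dual_circuit C) Xs \<longleftrightarrow> \<not> circuit_val C Xs"
proof -
  have ok: "wires_ok (dual_circuit C)"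
    using assms unfolding wires_ok_def dual_circuit_def by fastforce
  have "circuit_val (dual_circuit C) Xs \<longleftrightarrow> fold compare (map prod.swap (gates C))
      (\<lambda>i. annotation_val Xs (map negate_annotation (annots C) ! i)) (out_wire C)"
    unfolding circuit_val_compare[OF ok] by (simp add: dual_circuit_def)
  also have "\<dots> \<longleftrightarrow>
      fold compare (map prod.swap (gates C)) (\<lambda>i. \<not> annotation_val Xs (annots C ! i)) (out_wire C)"
    by (rule fold_compare_cong[where A = "{..<length (annots C)}"])
      (use wires_okD[OF assms] in \<open>auto simp: negate_annotation_val\<close>)
  finally show ?thesis by (simp add: fold_compare_swap circuit_val_compare[OF assms])
qed

lemma ac0_circuit_dual:
  assumes "ac0_circuit C"
  shows "ac0_circuit (\<lambda>v. dual_circuit (C v))"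
proof (rule ac0_circuitI)
  \<comment> \<open>On codes of annotations, the tags \<open>0\<close> and \<open>1\<close> of the
    two kinds of literals are exchanged; tag \<open>2\<close> comes with the bit of a constant,
    which is flipped by subtracting it from \<open>1\<close>.\<close>
  let ?n = "\<lambda>x. if fst (prod_decode x) = 0 then prod_encode (1, snd (prod_decode x))
    else if fst (prod_decode x) = 1 then prod_encode (0, snd (prod_decode x))
    else prod_encode (2, 1 - snd (prod_decode x))"
  have "ac0_fun (\<lambda>v. ?n (v 0))"
    by (intro ac0_fun_if definable_eq ac0_fun_prod_encode ac0_fun_fst_prod_decode
        ac0_fun_snd_prod_decode ac0_fun_diff ac0_fun_var ac0_fun_const)
  from ac0_list_map[where f = "\<lambda>x _. ?n x", OF ac0_circuitD(1)[OF assms] this]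
  have "ac0_list (\<lambda>v. map (?n \<circ> annotation_num) (annots (C v)))" by simp
  moreover have "?n \<circ> annotation_num = annotation_num \<circ> negate_annotation"
  proof
    show "(?n \<circ> annotation_num) \<alpha> = (annotation_num \<circ> negate_annotation) \<alpha>" for \<alpha>
      by (cases \<alpha>) auto
  qed
  ultimately show "ac0_list (\<lambda>v. map annotation_num (annots (dual_circuit (C v))))"
    by (simp add: dual_circuit_def)
  let ?s = "\<lambda>x. prod_encode (snd (prod_decode x), fst (prod_decode x))"
  have "ac0_fun (\<lambda>v. ?s (v 0))"
    by (intro ac0_fun_prod_encode ac0_fun_fst_prod_decode ac0_fun_snd_prod_decode ac0_fun_var)
  from ac0_list_map[where f = "\<lambda>x _. ?s x", OF ac0_circuitD(2)[OF assms] this]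
  have "ac0_list (\<lambda>v. map (?s \<circ> prod_encode) (gates (C v)))" by simp
  moreover have "?s \<circ> prod_encode = prod_encode \<circ> prod.swap" by auto
  ultimately show "ac0_list (\<lambda>v. map prod_encode (gates (dual_circuit (C v))))"
    by (simp add: dual_circuit_def)
  show "ac0_fun (\<lambda>v. out_wire (dual_circuit (C v)))"
    using ac0_circuitD(3)[OF assms] by (simp add: dual_circuit_def)
qed

text \<open>The padding gates act on the last two of the \<open>S\<close> wires, which must be fresh.\<close>

definition pad_circuit :: "nat \<Rightarrow> nat \<Rightarrow> circuit \<Rightarrow> circuit" where
  "pad_circuit S T C = Circuit (annots C @ replicate (S - length (annots C)) (Const False))
    (gates C @ replicate (T - length (gates C)) (S - 2, S - 1)) (out_wire C)"

text \<open>Two fresh wires are required because a gate has to join distinct wires.\<close>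

lemma pad_circuit_ok:
  assumes "circuit_ok ns C" and "length (annots C) + 2 \<le> S"
  shows "circuit_ok ns (pad_circuit S T C)"
  using assms unfolding circuit_ok_def pad_circuit_def by fastforce

text \<open>The padding gates come last and leave the output wire alone.\<close>

lemma pad_circuit_val:
  assumes "wires_ok C" and "length (annots C) + 2 \<le> S"
  shows "circuit_val (pad_circuit S T C) Xs \<longleftrightarrow> circuit_val C Xs"
proof -
  have ok: "wires_ok (pad_circuit S T C)"
    using assms unfolding wires_ok_def pad_circuit_def by fastforce
  have "circuit_val (pad_circuit S T C) Xs \<longleftrightarrow>
    fold compare (gates C) (\<lambda>i. annotation_val Xs (annots (pad_circuit S T C) ! i)) (out_wire C)"
    unfolding circuit_val_compare[OF ok] using wires_okD(4)[OF assms(1)] assms(2)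
    by (simp del: fold_replicate add: pad_circuit_def) (intro fold_compare_outside, auto)
  also have "\<dots> \<longleftrightarrow> circuit_val C Xs"
    unfolding circuit_val_compare[OF assms(1)] using wires_okD[OF assms(1)]
    by (intro fold_compare_cong[where A = "{..<length (annots C)}"])
      (auto simp: pad_circuit_def nth_append)
  finally show ?thesis .
qed

lemma ac0_circuit_pad:
  assumes "ac0_circuit C" and "ac0_fun S" and "ac0_fun T"
  shows "ac0_circuit (\<lambda>v. pad_circuit (S v) (T v) (C v))"
proof (rule ac0_circuitI)
  note C = ac0_circuitD[OF assms(1)]
  have "ac0_list (\<lambda>v. map annotation_num (annots (C v)) @
      replicate (S v - length (annots (C v))) (annotation_num (Const False)))"
    by (intro ac0_list_append ac0_list_replicate ac0_fun_diff C assms ac0_fun_const)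
  then show "ac0_list (\<lambda>v. map annotation_num (annots (pad_circuit (S v) (T v) (C v))))"
    by (simp add: pad_circuit_def)
  have "ac0_list (\<lambda>v. map prod_encode (gates (C v)) @
      replicate (T v - length (gates (C v))) (prod_encode (S v - 2, S v - 1)))"
    by (intro ac0_list_append ac0_list_replicate ac0_fun_diff ac0_fun_prod_encode C assms ac0_fun_const)
  then show "ac0_list (\<lambda>v. map prod_encode (gates (pad_circuit (S v) (T v) (C v))))"
    by (simp add: pad_circuit_def)
  show "ac0_fun (\<lambda>v. out_wire (pad_circuit (S v) (T v) (C v)))"
    using C(3) by (simp add: pad_circuit_def)
qed

section \<open>Composition of circuits\<close>

text \<open>
  Wire \<open>w\<close> of the circuit \<open>E\<close> is fed by the output of the circuit \<open>B w\<close>, all of which have \<open>S\<close>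
  wires; the annotations of \<open>E\<close> are ignored.
\<close>

definition plug_circuit :: "nat \<Rightarrow> circuit \<Rightarrow> (nat \<Rightarrow> circuit) \<Rightarrow> circuit" where
  "plug_circuit S E B = (let W = length (annots E); h = \<lambda>w. w * S + out_wire (B w) in
    Circuit (concat (map (\<lambda>w. annots (B w)) [0..<W]))
      (concat (map (\<lambda>w. map (map_prod ((+) (w * S)) ((+) (w * S))) (gates (B w))) [0..<W]) @
       map (map_prod h h) (gates E))
      (h (out_wire E)))"

lemma block_index_less:
  assumes "w < W" and "x < S"
  shows "w * S + x < W * (S :: nat)"
proof -
  have "w * S + x < Suc w * S" using assms(2) by simp
  also have "\<dots> \<le> W * S" using assms(1) by (intro mult_le_mono1) simp
  finally show ?thesis .
qed

lemma block_index_eq_iff: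
  assumes "x < S" and "y < S"
  shows "w * S + x = u * S + y \<longleftrightarrow> w = u \<and> x = (y :: nat)"
proof
  assume eq: "w * S + x = u * S + y"
  then have "(w * S + x) div S = (u * S + y) div S" by simp
  then have "w = u" using assms by simp
  with eq show "w = u \<and> x = y" by simp
qed simp

lemma length_concat_const:
  "(\<And>w. w < W \<Longrightarrow> length (xs w) = S) \<Longrightarrow> length (concat (map xs [0..<W])) = W * S"
  by (simp add: concat_equal_length[where d = undefined])

lemma nth_concat_const:
  assumes "\<And>w. w < W \<Longrightarrow> length (xs w) = S" and "w < W" and "x < S"
  shows "concat (map xs [0..<W]) ! (w * S + x) = xs w ! x"
  using assms block_index_less[OF assms(2,3)]
  by (simp add: concat_equal_length[where d = undefined] nth_default_nth)

context
  fixes S :: nat and E :: circuit and B :: "nat \<Rightarrow> circuit"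
  assumes E: "wires_ok E"
    and len: "\<And>w. w < length (annots E) \<Longrightarrow> length (annots (B w)) = S"
    and B: "\<And>w. w < length (annots E) \<Longrightarrow> wires_ok (B w)"
begin

lemma plug_out_less: "w < length (annots E) \<Longrightarrow> out_wire (B w) < S"
  using wires_okD(4)[OF B] len by metis

lemma plug_circuit_wires_ok: "wires_ok (plug_circuit S E B)"
proof -
  have "a < length (annots E) * S \<and> b < length (annots E) * S \<and> a \<noteq> b"
    if "(a, b) \<in> set (gates (plug_circuit S E B))" for a b
  proof -
    from that have "(\<exists>w < length (annots E). (a, b) \<in> map_prod ((+) (w * S)) ((+) (w * S)) ` set (gates (B w))) \<or>
        (a, b) \<in> map_prod (\<lambda>w. w * S + out_wire (B w)) (\<lambda>w. w * S + out_wire (B w)) ` set (gates E)"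
      by (auto simp: plug_circuit_def Let_def)
    then show ?thesis
    proof (elim disjE exE conjE imageE)
      fix w g assume w: "w < length (annots E)" and g: "(a, b) = map_prod ((+) (w * S)) ((+) (w * S)) g"
        "g \<in> set (gates (B w))"
      obtain c d where "g = (c, d)" by (cases g)
      with g wires_okD(1-3)[OF B[OF w], of c d] len[OF w] w show ?thesis
        by (auto intro: block_index_less)
    next
      fix g assume g: "(a, b) = map_prod (\<lambda>w. w * S + out_wire (B w)) (\<lambda>w. w * S + out_wire (B w)) g"
        "g \<in> set (gates E)"
      obtain c d where "g = (c, d)" by (cases g)
      with g wires_okD(1-3)[OF E, of c d] plug_out_less show ?thesis
        by (auto intro: block_index_less simp: block_index_eq_iff)
    qed
  qed
  moreover have "out_wire (plug_circuit S E B) < length (annots E) * S"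
    using block_index_less[OF wires_okD(4)[OF E] plug_out_less[OF wires_okD(4)[OF E]]]
    by (simp add: plug_circuit_def Let_def)
  moreover have "length (annots (plug_circuit S E B)) = length (annots E) * S"
    using len by (simp add: plug_circuit_def Let_def length_concat_const)
  ultimately show ?thesis unfolding wires_ok_def by auto
qed

text \<open>Induction over the number \<open>k\<close> of blocks already run. The wires of later
  blocks are part of the statement because block \<open>k\<close> must find its inputs
  unchanged.\<close>

lemma fold_compare_blocks:
  assumes "k \<le> length (annots E)" and "w < length (annots E)" and "x < S"
  shows "fold compare
      (concat (map (\<lambda>w. map (map_prod ((+) (w * S)) ((+) (w * S))) (gates (B w))) [0..<k])) f (w * S + x) \<longleftrightarrow>
    (if w < k then fold compare (gates (B w)) (\<lambda>x. f (w * S + x)) x else f (w * S + x))"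
  using assms
proof (induction k arbitrary: w x)
  case (Suc k)
  let ?m = "\<lambda>w. map (map_prod ((+) (w * S)) ((+) (w * S))) (gates (B w))"
  let ?f = "fold compare (concat (map ?m [0..<k])) f"
  have k: "k < length (annots E)" using Suc.prems by simp
  have step: "fold compare (concat (map ?m [0..<Suc k])) f = fold compare (?m k) ?f" by simp
  show ?case
  proof (cases "w = k")
    case True
    have "fold compare (?m k) ?f (k * S + x) \<longleftrightarrow> fold compare (gates (B k)) (\<lambda>x. f (k * S + x)) x"
      by (rule fold_compare_relabel[where A = "{..<S}"])
        (use Suc.IH[of k] k wires_okD[OF B[OF k]] len[OF k] Suc.prems in \<open>auto intro: inj_onI\<close>)
    then show ?thesis using True step by simp
  next
    case False
    have "fold compare (?m k) ?f (w * S + x) = ?f (w * S + x)"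
      by (rule fold_compare_outside)
        (use False wires_okD[OF B[OF k]] len[OF k] Suc.prems in \<open>auto simp: block_index_eq_iff\<close>)
    then show ?thesis using False step Suc by simp
  qed
qed simp

text \<open>After the blocks have run, wire \<open>?h w\<close> carries the output of
  \<open>B w\<close>. As \<open>?h\<close> is injective on the wires of \<open>E\<close>, the
  remaining gates act on these wires exactly as the gates of \<open>E\<close> do.\<close>

lemma plug_circuit_val:
  "circuit_val (plug_circuit S E B) Xs \<longleftrightarrow>
    fold compare (gates E) (\<lambda>w. circuit_val (B w) Xs) (out_wire E)"
proof -
  let ?W = "length (annots E)" and ?h = "\<lambda>w. w * S + out_wire (B w)"
  let ?f = "\<lambda>i. annotation_val Xs (concat (map (\<lambda>w. annots (B w)) [0..<?W]) ! i)"
  let ?g = "fold compare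
      (concat (map (\<lambda>w. map (map_prod ((+) (w * S)) ((+) (w * S))) (gates (B w))) [0..<?W])) ?f"
  have "?g (?h w) \<longleftrightarrow> circuit_val (B w) Xs" if w: "w < ?W" for w
  proof -
    have "?g (?h w) \<longleftrightarrow> fold compare (gates (B w)) (\<lambda>x. ?f (w * S + x)) (out_wire (B w))"
      using fold_compare_blocks[OF order_refl w plug_out_less[OF w]] w by simp
    also have "\<dots> \<longleftrightarrow> circuit_val (B w) Xs"
      unfolding circuit_val_compare[OF B[OF w]] using wires_okD[OF B[OF w]] len w
      by (intro fold_compare_cong[where A = "{..<S}"]) (auto simp: nth_concat_const)
    finally show ?thesis .
  qed
  then have "fold compare (map (map_prod ?h ?h) (gates E)) ?g (?h (out_wire E)) \<longleftrightarrow>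
      fold compare (gates E) (\<lambda>w. circuit_val (B w) Xs) (out_wire E)"
    using wires_okD[OF E] plug_out_less
    by (intro fold_compare_relabel[where A = "{..<?W}"]) (auto intro!: inj_onI simp: block_index_eq_iff)
  then show ?thesis
    unfolding circuit_val_compare[OF plug_circuit_wires_ok] by (simp add: plug_circuit_def Let_def)
qed

end

lemma plug_circuit_ok:
  assumes "wires_ok E" and "\<And>w. w < length (annots E) \<Longrightarrow> length (annots (B w)) = S"
    and "\<And>w. w < length (annots E) \<Longrightarrow> circuit_ok ns (B w)"
  shows "circuit_ok ns (plug_circuit S E B)"
proof -
  have "wires_ok (plug_circuit S E B)"
    using assms by (intro plug_circuit_wires_ok) (auto simp: circuit_ok_iff)
  then show ?thesis using assms(3) by (auto simp: circuit_ok_iff plug_circuit_def Let_def)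
qed

lemma ac0_circuit_plug:
  assumes E: "ac0_circuit E" and B: "ac0_circuit (\<lambda>v. B (v 0) (tail v))"
    and S: "ac0_fun S" and T: "ac0_fun T"
    and len: "\<And>v w. w < length (annots (E v)) \<Longrightarrow> length (annots (B w v)) = S v"
      "\<And>v w. w < length (annots (E v)) \<Longrightarrow> length (gates (B w v)) = T v"
  shows "ac0_circuit (\<lambda>v. plug_circuit (S v) (E v) (\<lambda>w. B w v))"
proof (rule ac0_circuitI)
  note E' = ac0_circuitD[OF E] and B' = ac0_circuitD[OF B]
  have B0: "ac0_fun (\<lambda>v. f v * S (g v) + out_wire (B (f v) (g v)))"
    if f: "ac0_fun f" and g: "\<And>i. ac0_fun (\<lambda>v. g v i)" for f g
    by (intro ac0_fun_add ac0_fun_mult f ac0_fun_subst[where g = "\<lambda>i v. g v i", OF S g]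
        ac0_fun_subst_bound[where g = "\<lambda>i v. g v i" and h = "\<lambda>w v. out_wire (B w v)", OF B'(3) f g])
  have "ac0_list (\<lambda>v. concat (map (\<lambda>w. map annotation_num (annots (B w v))) [0..<length (annots (E v))]))"
    using len(1) by (intro ac0_list_concat[where S = S] B' E' S) simp
  then show "ac0_list (\<lambda>v. map annotation_num (annots (plug_circuit (S v) (E v) (\<lambda>w. B w v))))"
    by (simp add: plug_circuit_def Let_def map_concat comp_def)
  \<comment> \<open>Shifts both wires of a coded gate by the offset \<open>d\<close> of its
    block.\<close>
  let ?m = "\<lambda>d x. prod_encode (d + fst (prod_decode x), d + snd (prod_decode x))"
  have m: "ac0_fun (\<lambda>v. ?m (v 1 * S (\<lambda>i. v (Suc (Suc i)))) (v 0))"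
    by (intro ac0_fun_prod_encode ac0_fun_add ac0_fun_fst_prod_decode ac0_fun_snd_prod_decode
        ac0_fun_mult ac0_fun_var ac0_fun_subst[OF S])
  have "ac0_list (\<lambda>v. map (\<lambda>x. ?m (v 0 * S (tail v)) x) (map prod_encode (gates (B (v 0) (tail v)))))"
    by (rule ac0_list_map[where f = "\<lambda>x v. ?m (v 0 * S (tail v)) x", OF B'(2)]) (use m in simp)
  then have "ac0_list (\<lambda>v. map (prod_encode \<circ> map_prod ((+) (v 0 * S (tail v))) ((+) (v 0 * S (tail v))))
      (gates (B (v 0) (tail v))))"
    by (rule back_subst[of ac0_list]) (simp add: comp_def map_prod_def split_def)
  then have blocks: "ac0_list (\<lambda>v. concat (map (\<lambda>w. map (prod_encode \<circ> map_prod ((+) (w * S v)) ((+) (w * S v)))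
      (gates (B w v))) [0..<length (annots (E v))]))"
    using len(2) by (intro ac0_list_concat[where S = T] E' T) simp_all
  let ?h = "\<lambda>w v. w * S v + out_wire (B w v)"
  have "ac0_fun (\<lambda>v. prod_encode (?h (fst (prod_decode (v 0))) (tail v), ?h (snd (prod_decode (v 0))) (tail v)))"
    by (intro ac0_fun_prod_encode B0 ac0_fun_fst_prod_decode ac0_fun_snd_prod_decode ac0_fun_var)
  from ac0_list_map[where f = "\<lambda>x v. prod_encode (?h (fst (prod_decode x)) v, ?h (snd (prod_decode x)) v)",
      OF E'(2) this]
  have "ac0_list (\<lambda>v. map (prod_encode \<circ> map_prod (\<lambda>w. ?h w v) (\<lambda>w. ?h w v)) (gates (E v)))"
    by (rule back_subst[of ac0_list]) (simp add: comp_def map_prod_def split_def)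
  from ac0_list_append[OF blocks this]
  show "ac0_list (\<lambda>v. map prod_encode (gates (plug_circuit (S v) (E v) (\<lambda>w. B w v))))"
    by (simp add: plug_circuit_def Let_def map_concat comp_def)
  show "ac0_fun (\<lambda>v. out_wire (plug_circuit (S v) (E v) (\<lambda>w. B w v)))"
    using B0[OF E'(3) ac0_fun_var] by (simp add: plug_circuit_def Let_def)
qed

section \<open>Closure properties\<close>

text \<open>The valuation holds the indices of the family as well as variables bound by quantifiers,
  and \<open>N\<close> computes the length of the string from it. Under a binder this length becomes
  \<open>N (tail v)\<close>, as it does not depend on the new variable.\<close>

definition cc_rel :: "((nat \<Rightarrow> nat) \<Rightarrow> nat) \<Rightarrow> ((nat \<Rightarrow> nat) \<Rightarrow> str \<Rightarrow> bool) \<Rightarrow> bool" where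
  "cc_rel N R \<longleftrightarrow> (\<exists>C. ac0_circuit C \<and> (\<forall>v. circuit_ok [N v] (C v)) \<and>
     (\<forall>v X. slen X = N v \<longrightarrow> (circuit_val (C v) [X] \<longleftrightarrow> R v X)))"

lemma cc_relI:
  "ac0_circuit C \<Longrightarrow> (\<And>v. circuit_ok [N v] (C v)) \<Longrightarrow>
   (\<And>v X. slen X = N v \<Longrightarrow> circuit_val (C v) [X] \<longleftrightarrow> R v X) \<Longrightarrow> cc_rel N R"
  unfolding cc_rel_def by blast

lemma cc_relE:
  assumes "cc_rel N R"
  obtains C where "ac0_circuit C" "\<And>v. circuit_ok [N v] (C v)" "\<And>v. wires_ok (C v)"
    "\<And>v X. slen X = N v \<Longrightarrow> circuit_val (C v) [X] \<longleftrightarrow> R v X"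
  using assms unfolding cc_rel_def circuit_ok_iff by blast

lemma cc_rel_cong:
  assumes "cc_rel N R" and "\<And>v X. slen X = N v \<Longrightarrow> R v X \<longleftrightarrow> Q v X"
  shows "cc_rel N Q"
  using assms unfolding cc_rel_def by simp

lemma cc_rel_not:
  assumes "cc_rel N R"
  shows "cc_rel N (\<lambda>v X. \<not> R v X)"
proof -
  obtain C where C: "ac0_circuit C" "\<And>v. circuit_ok [N v] (C v)" "\<And>v. wires_ok (C v)"
    "\<And>v X. slen X = N v \<Longrightarrow> circuit_val (C v) [X] \<longleftrightarrow> R v X"
    by (rule cc_relE[OF assms]) blast
  show ?thesis
    by (rule cc_relI[OF ac0_circuit_dual[OF C(1)]]) (simp_all add: C dual_circuit_ok dual_circuit_val)
qed

lemma cc_rel_if: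
  assumes "definable P" and "cc_rel N R" and "cc_rel N Q"
  shows "cc_rel N (\<lambda>v X. if P v then R v X else Q v X)"
proof -
  obtain C where C: "ac0_circuit C" "\<And>v. circuit_ok [N v] (C v)" "\<And>v. wires_ok (C v)"
    "\<And>v X. slen X = N v \<Longrightarrow> circuit_val (C v) [X] \<longleftrightarrow> R v X"
    by (rule cc_relE[OF assms(2)]) blast
  obtain D where D: "ac0_circuit D" "\<And>v. circuit_ok [N v] (D v)" "\<And>v. wires_ok (D v)"
    "\<And>v X. slen X = N v \<Longrightarrow> circuit_val (D v) [X] \<longleftrightarrow> Q v X"
    by (rule cc_relE[OF assms(3)]) blast
  show ?thesis
    by (rule cc_relI[OF ac0_circuit_if[OF assms(1) C(1) D(1)]]) (simp_all add: C D)
qed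

lemma cc_rel_const: "cc_rel N (\<lambda>_ _. b)"
  by (rule cc_relI[OF ac0_circuit_const_circuit[of b]]) (simp_all add: circuit_ok_def circuit_val_def)

lemma cc_rel_definable: "definable P \<Longrightarrow> cc_rel N (\<lambda>v _. P v)"
  by (rule back_subst[of "cc_rel N", OF cc_rel_if[of P, OF _ cc_rel_const[of N True] cc_rel_const[of N False]]])
    (auto simp: fun_eq_iff)

text \<open>The relation fed into wire \<open>w\<close> of \<open>E\<close> may be any
  \<open>R\<close> with uniform circuits that take \<open>w\<close> as an additional variable. Hence
  applications can be nested, which gives formulas with several quantifiers.\<close>

lemma cc_rel_plug:
  assumes E: "ac0_circuit E" "\<And>v. wires_ok (E v)"
    and R: "cc_rel (\<lambda>v. N (tail v)) (\<lambda>v X. R (v 0) (tail v) X)"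
  shows "cc_rel N (\<lambda>v X. fold compare (gates (E v)) (\<lambda>w. R w v X) (out_wire (E v)))"
proof -
  obtain C where C: "ac0_circuit C" "\<And>v. circuit_ok [N (tail v)] (C v)" "\<And>v. wires_ok (C v)"
    "\<And>v X. slen X = N (tail v) \<Longrightarrow> circuit_val (C v) [X] \<longleftrightarrow> R (v 0) (tail v) X"
    by (rule cc_relE[OF R]) blast
  have cons: "case_nat (v 0) (\<lambda>i. v (Suc i)) = v" for v :: "nat \<Rightarrow> nat"
    by (simp add: fun_eq_iff split: nat.split)
  let ?W = "\<lambda>v. length (annots (E v))"
  have W: "ac0_fun ?W" by (rule ac0_circuitD(4)[OF E(1)])
  have "ac0_fun (\<lambda>v. length (annots (C (case_nat (v 0) (tail v)))))"
    by (simp add: cons ac0_circuitD[OF C(1)])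
  from ac0_fun_uniform_bound[where h = "\<lambda>w v. length (annots (C (case_nat w v)))", OF this W]
  obtain s where s: "term_fun s" "\<And>v w. w \<le> ?W v \<Longrightarrow> length (annots (C (case_nat w v))) \<le> s v" by blast
  have "ac0_fun (\<lambda>v. length (gates (C (case_nat (v 0) (tail v)))))"
    by (simp add: cons ac0_circuitD[OF C(1)])
  from ac0_fun_uniform_bound[where h = "\<lambda>w v. length (gates (C (case_nat w v)))", OF this W]
  obtain T where T: "term_fun T" "\<And>v w. w \<le> ?W v \<Longrightarrow> length (gates (C (case_nat w v))) \<le> T v" by blast
  \<comment> \<open>Two wires beyond the bound host the padding gates.\<close>
  let ?S = "\<lambda>v. s v + 2"
  have S: "ac0_fun ?S" by (intro ac0_fun_add ac0_fun_term[OF s(1)] ac0_fun_const)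
  have T': "ac0_fun T" by (rule ac0_fun_term[OF T(1)])
  let ?B = "\<lambda>w v. pad_circuit (?S v) (T v) (C (case_nat w v))"
  have B: "ac0_circuit (\<lambda>v. ?B (v 0) (tail v))"
    unfolding cons by (intro ac0_circuit_pad C ac0_fun_tail[OF S] ac0_fun_tail[OF T'])
  have len: "length (annots (?B w v)) = ?S v" "length (gates (?B w v)) = T v" if "w < ?W v" for v w
    using s(2)[of w v] T(2)[of w v] that by (simp_all add: pad_circuit_def)
  have ok: "circuit_ok [N v] (?B w v)" if "w < ?W v" for v w
    using C(2)[of "case_nat w v"] s(2)[of w v] that by (intro pad_circuit_ok) auto
  show ?thesis
  proof (rule cc_relI)
    show "ac0_circuit (\<lambda>v. plug_circuit (?S v) (E v) (\<lambda>w. ?B w v))"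
      by (rule ac0_circuit_plug[where B = ?B, OF E(1) B S T' len])
    show "circuit_ok [N v] (plug_circuit (?S v) (E v) (\<lambda>w. ?B w v))" for v
      by (rule plug_circuit_ok[OF E(2) len(1) ok])
    show "circuit_val (plug_circuit (?S v) (E v) (\<lambda>w. ?B w v)) [X] \<longleftrightarrow>
        fold compare (gates (E v)) (\<lambda>w. R w v X) (out_wire (E v))" if X: "slen X = N v" for v X
    proof -
      have "circuit_val (?B w v) [X] \<longleftrightarrow> R w v X" if "w < ?W v" for w
        using C(4)[of X "case_nat w v"] X s(2)[of w v] that pad_circuit_val[OF C(3)] by simp
      then have "fold compare (gates (E v)) (\<lambda>w. circuit_val (?B w v) [X]) (out_wire (E v)) \<longleftrightarrow>
          fold compare (gates (E v)) (\<lambda>w. R w v X) (out_wire (E v))"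
        using wires_okD[OF E(2)] by (intro fold_compare_cong[where A = "{..<?W v}"]) auto
      moreover have "wires_ok (?B w v)" if "w < ?W v" for w
        using ok[OF that] by (simp add: circuit_ok_iff)
      ultimately show ?thesis using plug_circuit_val[OF E(2) len(1)] by simp
    qed
  qed
qed

text \<open>The second wire of a gate receives the disjunction, so wire \<open>0\<close> accumulates
  it; wire \<open>Suc t\<close> is untouched until its own gate reads it.\<close>

lemma fold_compare_or_chain:
  "fold compare (map (\<lambda>t. (Suc t, 0)) [0..<k]) f 0 \<longleftrightarrow> (\<exists>w \<le> k. f w)"
proof (induction k)
  case (Suc k)
  have "fold compare (map (\<lambda>t. (Suc t, 0)) [0..<k]) f (Suc k) = f (Suc k)"
    by (rule fold_compare_outside) auto
  with Suc show ?case by (auto simp: le_Suc_eq)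
qed simp

lemma cc_rel_ex:
  assumes k: "ac0_fun k" and R: "cc_rel (\<lambda>v. N (tail v)) (\<lambda>v X. R (v 0) (tail v) X)"
  shows "cc_rel N (\<lambda>v X. \<exists>w \<le> k v. R w v X)"
proof -
  let ?E = "\<lambda>v. Circuit (replicate (Suc (k v)) (Const False)) (map (\<lambda>t. (Suc t, 0)) [0..<k v]) 0"
  have "ac0_circuit ?E"
  proof (rule ac0_circuitI)
    have "ac0_list (\<lambda>v. replicate (k v + 1) (annotation_num (Const False)))"
      by (intro ac0_list_replicate ac0_fun_add k ac0_fun_const)
    then show "ac0_list (\<lambda>v. map annotation_num (annots (?E v)))" by simp
    have "ac0_list (\<lambda>v. map (\<lambda>t. prod_encode (t + 1, 0)) [0..<k v])"
      by (intro ac0_list_map_upt k ac0_fun_prod_encode ac0_fun_add ac0_fun_const ac0_fun_var)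
    then show "ac0_list (\<lambda>v. map prod_encode (gates (?E v)))" by (simp add: comp_def)
    show "ac0_fun (\<lambda>v. out_wire (?E v))" by (simp add: ac0_fun_const)
  qed
  moreover have "wires_ok (?E v)" for v by (auto simp: wires_ok_def)
  ultimately have "cc_rel N (\<lambda>v X. fold compare (gates (?E v)) (\<lambda>w. R w v X) (out_wire (?E v)))"
    using R by (rule cc_rel_plug)
  then show ?thesis by (simp only: circuit.sel fold_compare_or_chain)
qed

lemma cc_rel_all:
  assumes "ac0_fun k" and "cc_rel (\<lambda>v. N (tail v)) (\<lambda>v X. R (v 0) (tail v) X)"
  shows "cc_rel N (\<lambda>v X. \<forall>w \<le> k v. R w v X)"
  using cc_rel_not[OF cc_rel_ex[where R = "\<lambda>w v X. \<not> R w v X", OF assms(1) cc_rel_not[OF assms(2)]]]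
  by simp

section \<open>Translation between \<open>CC\<close> and uniform circuits over valuations\<close>

lemma CC_imp_ac0_circuit:
  assumes "R \<in> CC 1 1"
  obtains C where "ac0_circuit (\<lambda>v. C (v 0) (v 1))" "\<And>i n. circuit_ok [n] (C i n)"
    "\<And>i X. circuit_val (C i (slen X)) [X] \<longleftrightarrow> R [i] [X]"
proof -
  obtain C where fac0: "(\<lambda>ys _. circuit_code (C ys)) \<in> FAC0 (1 + 1) 0"
    and ok: "\<forall>xs ns. length xs = 1 \<longrightarrow> length ns = 1 \<longrightarrow> circuit_ok ns (C (xs @ ns))"
    and val: "\<forall>xs Xs. length xs = 1 \<longrightarrow> length Xs = 1 \<longrightarrow>
        (R xs Xs \<longleftrightarrow> circuit_val (C (xs @ map slen Xs)) Xs)"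
    using assms unfolding CC_def by auto
  obtain p :: "nat poly" where p': "\<forall>ys Xs :: str list. length ys = 1 + 1 \<longrightarrow> length Xs = 0 \<longrightarrow>
      slen (circuit_code (C ys)) \<le> poly p (sum_list ys + sum_list (map slen Xs))"
    using fac0 unfolding FAC0_def function_class_def p_bounded_def input_size_def by blast
  have p: "slen (circuit_code (C [i, n])) \<le> poly p (i + n)" for i n
    using p'[rule_format, of "[i, n]" "[]"] by simp
  obtain \<phi> where \<phi>: "\<forall>xs Xs. length xs = 3 \<longrightarrow> length Xs = 0 \<longrightarrow>
      (bit_graph (\<lambda>ys _. circuit_code (C ys)) xs Xs \<longleftrightarrow>
       fm_val (nth_default 0 xs) (nth_default {||} Xs) \<phi>)"
    using fac0 unfolding FAC0_def function_class_def AC0_def by (auto simp: numeral_3_eq_3)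
  \<comment> \<open>The three variables are the bit position in the code and the two indices of the
    family. The formula reads a list extended by \<open>0\<close>, so all further variables are
    replaced by \<open>0\<close>.\<close>
  have "definable (\<lambda>v. fm_val (\<lambda>i. (if i < 3 then (\<lambda>v. v i) else (\<lambda>_. 0)) v) (\<lambda>_. {||}) \<phi>)"
    by (rule definable_term_subst[OF definable_fm_val]) (simp add: term_fun_var term_fun_const)
  moreover have "(\<lambda>i. (if i < 3 then (\<lambda>v. v i) else (\<lambda>_. 0)) v) = nth_default 0 [v 0, v 1, v 2]"
    for v :: "nat \<Rightarrow> nat"
    by (auto simp: fun_eq_iff nth_default_def nth_Cons numeral_2_eq_2 split: nat.split)
  moreover have "nth_default {||} [] = (\<lambda>_. {||} :: str)" by (simp add: fun_eq_iff nth_default_def)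
  ultimately have "definable (\<lambda>v. v 0 |\<in>| circuit_code (C [v 1, v 2]))"
    using \<phi>[rule_format, of "[_, _, _]" "[]"] by (simp add: bit_graph_def)
  then have "ac0_circuit (\<lambda>v. C [v 0, v 1])"
    using p by (intro ac0_circuitI_code[where b = "\<lambda>v. poly p (v 0 + v 1)"] term_fun_poly
        term_fun_add term_fun_var) (simp_all add: numeral_2_eq_2)
  moreover have "circuit_ok [n] (C [i, n])" for i n using ok[rule_format, of "[i]" "[n]"] by simp
  moreover have "circuit_val (C [i, slen X]) [X] \<longleftrightarrow> R [i] [X]" for i X
    using val[rule_format, of "[i]" "[X]"] by simp
  ultimately show thesis by (rule that[of "\<lambda>i n. C [i, n]"])
qed

text \<open>Polynomial size comes from uniformity: the numbers of wires and gates are uniform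
  functions and hence bounded by a term.\<close>

lemma cc_rel_imp_CC:
  assumes "cc_rel (\<lambda>v. v 1) (\<lambda>v X. R [v 0] [X])"
  shows "R \<in> CC 1 1"
proof -
  obtain C where C: "ac0_circuit C" "\<And>v. circuit_ok [v 1] (C v)" "\<And>v. wires_ok (C v)"
    "\<And>v X. slen X = v 1 \<Longrightarrow> circuit_val (C v) [X] \<longleftrightarrow> R [v 0] [X]"
    by (rule cc_relE[OF assms]) blast
  let ?C = "\<lambda>ys. C (nth_default 0 ys)"
  \<comment> \<open>No entry exceeds the sum of the list, so term bounds become polynomials in that
    sum.\<close>
  have le_sum: "nth_default 0 ys i \<le> sum_list ys" for ys :: "nat list" and i
    by (simp add: nth_default_def member_le_sum_list)
  obtain b where b: "term_fun b" "\<And>v. slen (circuit_code (C v)) \<le> b v"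
    using slen_circuit_code_bound[OF C(1)] by blast
  obtain p :: "nat poly" where p: "\<And>v m. (\<forall>i. v i \<le> m) \<Longrightarrow> b v \<le> poly p m"
    using term_fun_le_poly[OF b(1)] by blast
  have bounded: "slen (circuit_code (?C ys)) \<le> poly p (sum_list ys)" for ys
    using order_trans[OF b(2) p] le_sum by blast
  obtain l where l: "term_fun l" "\<And>v. circuit_size (C v) \<le> l v"
    using ac0_fun_bound[OF ac0_fun_add[OF ac0_circuitD(4,5)[OF C(1)]]]
    unfolding circuit_size_def by blast
  obtain q :: "nat poly" where q: "\<And>v m. (\<forall>i. v i \<le> m) \<Longrightarrow> l v \<le> poly q m"
    using term_fun_le_poly[OF l(1)] by blast
  have size: "circuit_size (?C ys) \<le> poly q (sum_list ys)" for ys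
    using order_trans[OF l(2) q] le_sum by blast
  obtain \<phi> where \<phi>: "\<And>v. v 0 |\<in>| circuit_code (C (tail v)) \<longleftrightarrow> fm_val v (\<lambda>_. {||}) \<phi>"
    using definable_circuit_code[OF C(1)] unfolding definable_def by blast
  have code: "bit_graph (\<lambda>ys _. circuit_code (?C ys)) xs Xs \<longleftrightarrow>
      fm_val (nth_default 0 xs) (nth_default {||} Xs) \<phi>" if len: "length xs = 3" "length Xs = 0" for xs Xs
  proof -
    obtain y ys where "xs = y # ys" using len(1) by (cases xs) auto
    moreover have "nth_default {||} [] = (\<lambda>_. {||} :: str)" by (simp add: fun_eq_iff nth_default_def)
    ultimately show ?thesis using len(2) \<phi>[of "nth_default 0 xs"] by (simp add: bit_graph_def)
  qed
  have "(\<lambda>ys _. circuit_code (?C ys)) \<in> FAC0 (1 + 1) 0"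
    unfolding FAC0_def function_class_def p_bounded_def AC0_def input_size_def
    using bounded code by (auto simp: numeral_3_eq_3)
  moreover have "circuit_ok ns (?C (xs @ ns))" if "length xs = 1" "length ns = 1" for xs ns
    using that C(2)[of "nth_default 0 (xs @ ns)"] by (auto simp: length_Suc_conv)
  moreover have "R xs Xs \<longleftrightarrow> circuit_val (?C (xs @ map slen Xs)) Xs"
    if "length xs = 1" "length Xs = 1" for xs Xs
    using that C(4)[of _ "nth_default 0 (xs @ map slen Xs)"] by (auto simp: length_Suc_conv)
  ultimately show ?thesis unfolding CC_def using size by (auto intro!: exI[of _ ?C] exI[of _ q])
qed

section \<open>Recognising a length from bits, and the composed function\<close>

text \<open>Bit \<open>m - 1\<close> being set and all later ones up to \<open>q\<close> being unset
  pins down the length. The condition \<open>m \<le> q\<close> excludes lengths whose deciding bit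
  lies outside the tested range; for \<open>m = 0\<close> no \<open>j\<close> meets the first case.
  The nested cases fit the closure properties of \<open>cc_rel\<close>.\<close>

lemma slen_eq_iff_bits:
  assumes "slen Y \<le> q"
  shows "slen Y = m \<longleftrightarrow>
    m \<le> q \<and> (\<forall>j \<le> q. if j + 1 = m then j |\<in>| Y else if m \<le> j then j |\<notin>| Y else True)"
proof
  assume m: "slen Y = m"
  have "j |\<in>| Y" if "Suc j = m" for j
  proof (rule ccontr)
    assume "j |\<notin>| Y"
    moreover have "x < m" if "x |\<in>| Y" for x using m slen_le_iff[of Y m] that by simp
    ultimately have "slen Y \<le> j" unfolding slen_le_iff using \<open>Suc j = m\<close> by (metis less_antisym)
    with m \<open>Suc j = m\<close> show False by simp
  qed
  moreover have "j |\<notin>| Y" if "m \<le> j" for j using m slen_le_iff[of Y m] that by auto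
  ultimately show "m \<le> q \<and> (\<forall>j \<le> q. if j + 1 = m then j |\<in>| Y else if m \<le> j then j |\<notin>| Y else True)"
    using assms m by simp
next
  assume R: "m \<le> q \<and> (\<forall>j \<le> q. if j + 1 = m then j |\<in>| Y else if m \<le> j then j |\<notin>| Y else True)"
  have "x < m" if "x |\<in>| Y" for x
  proof (rule ccontr)
    assume "\<not> x < m"
    moreover have "x \<le> q" using assms that unfolding slen_le_iff by (simp add: less_imp_le)
    ultimately show False using R that by auto
  qed
  then have "slen Y \<le> m" unfolding slen_le_iff by blast
  moreover have "m \<le> slen Y"
  proof (cases m)
    case (Suc j)
    then have "j |\<in>| Y" using R by simp
    then show ?thesis using slen_le_iff[of Y "slen Y"] Suc by auto
  qed simp
  ultimately show "slen Y = m" by simp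
qed

lemma nat_poly_mono: "x \<le> y \<Longrightarrow> poly p x \<le> poly p (y :: nat)"
  by (induction p) (auto intro: add_mono mult_le_mono)

theorem theorem11:
  fixes F G :: "str \<Rightarrow> str"
  assumes "F \<in> FCC" and "G \<in> FCC"
  shows "(\<lambda>X. F (G X)) \<in> FCC"
proof -
  have p_bounded_iff: "p_bounded 0 1 (\<lambda>_ Xs. H (hd Xs)) \<longleftrightarrow>
      (\<exists>p :: nat poly. \<forall>X. slen (H X) \<le> poly p (slen X))" for H :: "str \<Rightarrow> str"
  proof -
    have "(\<forall>Xs :: str list. length Xs = 1 \<longrightarrow> P Xs) \<longleftrightarrow> (\<forall>X. P [X])" for P
      by (auto simp: length_Suc_conv)
    then show ?thesis unfolding p_bounded_def input_size_def by simp
  qed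
  have FCC_iff: "H \<in> FCC \<longleftrightarrow> (\<exists>p :: nat poly. \<forall>X. slen (H X) \<le> poly p (slen X)) \<and>
      bit_graph (\<lambda>_ Xs. H (hd Xs)) \<in> CC 1 1" for H :: "str \<Rightarrow> str"
    unfolding FCC_def function_class_def mem_Collect_eq p_bounded_iff by simp
  obtain p :: "nat poly" where p: "\<And>Y. slen (F Y) \<le> poly p (slen Y)"
    using assms(1) FCC_iff by blast
  obtain q :: "nat poly" where q: "\<And>X. slen (G X) \<le> poly q (slen X)"
    using assms(2) FCC_iff by blast
  obtain CF where CF: "ac0_circuit (\<lambda>v. CF (v 0) (v 1))" "\<And>i n. circuit_ok [n] (CF i n)"
    "\<And>i Y. circuit_val (CF i (slen Y)) [Y] \<longleftrightarrow> i |\<in>| F Y"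
    using assms(1) CC_imp_ac0_circuit[of "bit_graph (\<lambda>_ Xs. F (hd Xs))"]
    unfolding FCC_iff bit_graph_def by auto
  obtain CG where CG: "ac0_circuit (\<lambda>v. CG (v 0) (v 1))" "\<And>i n. circuit_ok [n] (CG i n)"
    "\<And>i Y. circuit_val (CG i (slen Y)) [Y] \<longleftrightarrow> i |\<in>| G Y"
    using assms(2) CC_imp_ac0_circuit[of "bit_graph (\<lambda>_ Xs. G (hd Xs))"]
    unfolding FCC_iff bit_graph_def by auto
  have subst2: "ac0_circuit (\<lambda>v. C (f v) (g v))"
    if "ac0_circuit (\<lambda>v. C (v 0) (v 1))" "ac0_fun f" "ac0_fun g" for C :: "nat \<Rightarrow> nat \<Rightarrow> circuit" and f g
    using ac0_circuit_subst[where g = "\<lambda>i. if i = 0 then f else g", OF that(1)] that(2,3) by simp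
  have wires: "wires_ok (CF i n)" for i n using CF(2) circuit_ok_iff by blast
  have G_bit: "cc_rel N (\<lambda>v X. f v |\<in>| G X)" if "ac0_fun f" "ac0_fun N" for f N
    by (rule cc_relI[OF subst2[OF CG(1) that]]) (auto simp: CG(2) CG(3)[symmetric])

  \<comment> \<open>The initial value on wire \<open>w\<close> of the circuit of \<open>F\<close>
    for length \<open>m\<close>, on a string \<open>Y\<close> that need not have this length. It is
    false beyond the last wire, so it is given for every \<open>w\<close>.\<close>
  define input where "input i m w Y \<longleftrightarrow>
    w < length (annots (CF i m)) \<and> annotation_val [Y] (annots (CF i m) ! w)" for i m w Y
  \<comment> \<open>Only the correct guess \<open>m\<close> has to be considered: for every other
    one the length test in \<open>R\<close> will fail.\<close>
  have F_val: "fold compare (gates (CF i m)) (\<lambda>w. input i m w Y) (out_wire (CF i m)) \<longleftrightarrow> i |\<in>| F Y"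
    if "slen Y = m" for i m Y
    unfolding CF(3)[symmetric] that circuit_val_compare[OF wires] input_def using wires_okD[OF wires]
    by (intro fold_compare_cong[where A = "{..<length (annots (CF i m))}"]) auto
  \<comment> \<open>The circuit has a single input string, so the string index in a literal is
    \<open>0\<close> and only its bit position is read. For a constant, \<open>a\<close> is the bit
    itself.\<close>
  have input_num: "input i m w Y \<longleftrightarrow>
      (let c = nth_default 0 (map annotation_num (annots (CF i m))) w;
           k = fst (prod_decode c); a = snd (prod_decode c)
       in if length (annots (CF i m)) \<le> w then False
          else if k = 0 then snd (prod_decode a) |\<in>| Y
          else if k = 1 then \<not> snd (prod_decode a) |\<in>| Y
          else a = 1)" for i m w Y
  proof (cases "w < length (annots (CF i m))")
    case True
    then have "annotation_ok [m] (annots (CF i m) ! w)" using CF(2)[of m i] by (auto simp: circuit_ok_def)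
    then show ?thesis using True
      by (cases "annots (CF i m) ! w") (auto simp: input_def nth_default_def)
  qed (simp add: input_def)
  \<comment> \<open>Definable tests on the decoded annotation select among a bit of
    \<open>G X\<close>, its negation and a definable truth value, all of which have uniform
    circuits.\<close>
  have input: "cc_rel N (\<lambda>v X. input (f v) (g v) (h v) (G X))"
    if "ac0_fun f" "ac0_fun g" "ac0_fun h" "ac0_fun N" for f g h N
    unfolding input_num Let_def
    by (intro cc_rel_if cc_rel_const G_bit cc_rel_not cc_rel_definable definable_le definable_eq
        ac0_fun_fst_prod_decode ac0_fun_snd_prod_decode ac0_fun_nth_default ac0_circuitD(1,4) subst2[OF CF(1)]
        ac0_fun_const that)

  \<comment> \<open>The conjunction is absorbed into the universal quantifier: the additional index
    \<open>poly q n + 1\<close> carries the run of the circuit of \<open>F\<close>, the smaller ones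
    test the length \<open>m\<close>.\<close>
  define R where "R i n X \<longleftrightarrow> (\<exists>m \<le> poly q n. \<forall>j \<le> poly q n + 1.
      if j = poly q n + 1 then fold compare (gates (CF i m)) (\<lambda>w. input i m w (G X)) (out_wire (CF i m))
      else if j + 1 = m then j |\<in>| G X else if m \<le> j then \<not> j |\<in>| G X else True)" for i n X
  have poly: "ac0_fun (\<lambda>v. poly q (v i))" for i by (intro ac0_fun_term term_fun_poly term_fun_var)
  have R_cc: "cc_rel (\<lambda>v. v 1) (\<lambda>v X. R (v 0) (v 1) X)"
    unfolding R_def
    by (intro cc_rel_ex cc_rel_all cc_rel_if cc_rel_plug cc_rel_const G_bit input cc_rel_not
        wires subst2[OF CF(1)] definable_le definable_eq poly ac0_fun_add ac0_fun_var ac0_fun_const)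
  have R_iff: "R i (slen X) X \<longleftrightarrow> i |\<in>| F (G X)" for i X
  proof -
    let ?q = "poly q (slen X)"
    have split: "(\<forall>j \<le> ?q + 1. if j = ?q + 1 then A else P j) \<longleftrightarrow> A \<and> (\<forall>j \<le> ?q. P j)" for A P
      by (auto simp: le_Suc_eq)
    \<comment> \<open>Exactly one \<open>m\<close> passes the length test, and for this one
      \<open>F_val\<close> applies.\<close>
    have "R i (slen X) X \<longleftrightarrow> (\<exists>m. slen (G X) = m \<and>
        fold compare (gates (CF i m)) (\<lambda>w. input i m w (G X)) (out_wire (CF i m)))"
      unfolding R_def split slen_eq_iff_bits[OF q] by blast
    then show ?thesis using F_val by blast
  qed
  have "cc_rel (\<lambda>v. v 1) (\<lambda>v X. bit_graph (\<lambda>_ Xs. F (G (hd Xs))) [v 0] [X])"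
    by (rule cc_rel_cong[OF R_cc]) (simp add: bit_graph_def R_iff[symmetric])
  then have "bit_graph (\<lambda>_ Xs. F (G (hd Xs))) \<in> CC 1 1" by (rule cc_rel_imp_CC)
  moreover have "slen (F (G X)) \<le> poly (pcompose p q) (slen X)" for X
    using order_trans[OF p nat_poly_mono[OF q]] by (simp add: poly_pcompose)
  ultimately show ?thesis unfolding FCC_iff by blast
qed

end
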